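(* Let $(X,0)\subset(\mathbb{C}^n,0)$ be an irreducible germ of a Segre nondegenerate $n$-dimensional real-analytic subvariety of Segre multiplicity $k$, and let $\mathcal{A}\colon\mathbb{C}\{z,\bar z\}\to\mathbb{C}\{z\}$ be its averaging operator. Let $f(z,\bar z)\in\mathbb{C}\{z,\bar z\}$ be (the germ at $0$ of) a real-analytic function. Then $f|_X\in\mathbb{C}\{z\}$ (that is, $f|_X$ is the restriction to $(X,0)$ of a germ at $0$ of a holomorphic function) if and only if $$\mathcal{A}(f^\ell)=(\mathcal{A}f)^\ell\quad\text{for all }\ell=1,\ldots,k.$$
   Context: $\mathbb{C}\{z\}$ and $\mathbb{C}\{z,\bar z\}$ denote the rings of convergent power series, i.e. germs at $0\in\mathbb{C}^n$ of holomorphic, respectively complex-valued real-analytic, functions. "$n$-dimensional" means of real dimension $n$. For a germ $(X,0)\subset(\mathbb{C}^n,0)$ of a real-analytic subvariety, $\mathcal{I}_0(X)\subset\mathbb{C}\{z,\bar z\}$ is the ideal of germs vanishing on $X$. $(X,0)$ is Segre nondegenerate if the ideal $\mathcal{J}=\{\varrho(z,0):\varrho\in\mathcal{I}_0(X)\}\subset\mathbb{C}\{z\}$ satisfies $\mathfrak{m}^s\subset\mathcal{J}$ for some $s\in\mathbb{N}$, $\mathfrak{m}$ being the maximal ideal (equivalently $V(\mathcal{J})=\{0\}$). The complexification $\mathcal{X}$ of $(X,0)$ is the germ at $0$ of the complex subvariety of $\mathbb{C}^n_z\times\mathbb{C}^n_\xi$ with ideal $\{\varrho(z,\xi):\varrho(z,\bar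 z)\in\mathcal{I}_0(X)\}$, i.e. the smallest germ of a complex subvariety containing $\{(z,\bar z):z\in X\}$; it has complex dimension $n$. Let $\pi_1(z,\xi)=z$. For suitable arbitrarily small polydiscs $\Delta_z,\Delta_\xi$ centered at $0$, $\mathcal{X}$ is represented by a closed irreducible subvariety of $\Delta_z\times\Delta_\xi$, $\pi_1|_{\mathcal{X}}$ is finite (proper with finite fibers) over $\Delta_z$, $(\pi_1|_{\mathcal{X}})^{-1}(0)=\{0\}$, and for each $z\in\Delta_z$ the fiber $(\pi_1|_{\mathcal{X}})^{-1}(z)$ consists of exactly $k$ points $(z,\xi^1(z)),\dots,(z,\xi^k(z))$ counted with multiplicity (generically distinct). The integer $k$ is the Segre multiplicity of $(X,0)$. The averaging operator $\mathcal{A}\colon\mathbb{C}\{z,\bar z\}\to\mathbb{C}\{z\}$ is $(\mathcal{A}f)(z)=\frac1k\sum_{j=1}^k f(z,\xi^j(z))$, where $f(z,\xi)$ is the convergent power series obtained from $f(z,\bar z)$ by replacing $\bar z$ by $\xi$; this is a holomorphic germ at $0$. *)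

theory Defs
  imports "HOL-Analysis.Analysis"
begin

section \<open>Convergent power series and germs\<close>

text \<open>Germs at \<open>0\<close> are represented by functions (or sets) defined everywhere, of which only the
  behaviour near \<open>0\<close> matters; equality of germs is equality in a neighbourhood of \<open>0\<close>.\<close>

abbreviation germ_eq :: "(complex^'m \<Rightarrow> complex) \<Rightarrow> (complex^'m \<Rightarrow> complex) \<Rightarrow> bool"
  where "germ_eq f g \<equiv> eventually (\<lambda>z. f z = g z) (nhds 0)"

abbreviation set_germ_eq :: "(complex^'m) set \<Rightarrow> (complex^'m) set \<Rightarrow> bool"
  where "set_germ_eq A B \<equiv> eventually (\<lambda>z. z \<in> A \<longleftrightarrow> z \<in> B) (nhds 0)"

text \<open>The power \<open>z\<^sup>\<alpha>\<close> for a multi-index \<open>\<alpha>\<close>.\<close>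

definition monomial :: "('m::finite \<Rightarrow> nat) \<Rightarrow> complex^'m \<Rightarrow> complex"
  where "monomial \<alpha> z = (\<Prod>i\<in>UNIV. (z $ i) ^ \<alpha> i)"

text \<open>Summability over multi-indices is unconditional, hence absolute.\<close>

definition holo_at :: "(complex^'m::finite \<Rightarrow> complex) \<Rightarrow> complex^'m \<Rightarrow> bool"
  where "holo_at F p \<longleftrightarrow>
    (\<exists>c r. 0 < r \<and>
      (\<forall>x. (\<forall>i. cmod (x $ i - p $ i) < r) \<longrightarrow>
        ((\<lambda>\<alpha>. c \<alpha> * monomial \<alpha> (x - p)) has_sum F x) UNIV))"

definition polydisc :: "('m::finite \<Rightarrow> real) \<Rightarrow> (complex^'m) set"
  where "polydisc r = {z. \<forall>i. cmod (z $ i) < r i}"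

text \<open>The space \<open>\<complex>\<^sup>n\<^sub>z \<times> \<complex>\<^sup>n\<^sub>\<xi>\<close> is \<^typ>\<open>complex^('n + 'n)\<close>, so that the notions above apply to it.\<close>

definition pt :: "complex^'n \<Rightarrow> complex^'n \<Rightarrow> complex^('n + 'n)"
  where "pt z \<xi> = (\<chi> i. case i of Inl j \<Rightarrow> z $ j | Inr j \<Rightarrow> \<xi> $ j)"

definition proj1 :: "complex^('n + 'n) \<Rightarrow> complex^'n"
  where "proj1 w = (\<chi> j. w $ Inl j)"

definition vcnj :: "complex^'n \<Rightarrow> complex^'n"
  where "vcnj z = (\<chi> j. cnj (z $ j))"

text \<open>By the definition of \<^const>\<open>holo_at\<close>, this says that \<open>f\<close> is near \<open>p\<close> the sum of a convergent
  power series in \<open>z - p\<close> and its conjugate.\<close>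

definition real_analytic_at :: "(complex^'n::finite \<Rightarrow> complex) \<Rightarrow> complex^'n \<Rightarrow> bool"
  where "real_analytic_at f p \<longleftrightarrow>
    (\<exists>F. holo_at F (pt p (vcnj p)) \<and> eventually (\<lambda>z. f z = F (pt z (vcnj z))) (nhds p))"

text \<open>\<open>f(z, \<xi>)\<close>, obtained from \<open>f(z, cnj z)\<close> by replacing \<open>cnj z\<close> by \<open>\<xi>\<close>; the choice is unique
  as a germ at \<open>0\<close>.\<close>

definition complexify :: "(complex^'n::finite \<Rightarrow> complex) \<Rightarrow> complex^('n + 'n) \<Rightarrow> complex"
  where "complexify f = (SOME F. holo_at F 0 \<and> germ_eq f (\<lambda>z. F (pt z (vcnj z))))"


section \<open>Germs of real-analytic subvarieties\<close>

definition real_subvariety_germ :: "(complex^'n::finite) set \<Rightarrow> bool"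
  where "real_subvariety_germ X \<longleftrightarrow>
    (\<exists>U R. open U \<and> 0 \<in> U \<and> finite R \<and> (\<forall>\<rho>\<in>R. \<forall>p\<in>U. real_analytic_at \<rho> p) \<and>
       X \<inter> U = {z \<in> U. \<forall>\<rho>\<in>R. \<rho> z = 0})"

definition irreducible_real_germ :: "(complex^'n::finite) set \<Rightarrow> bool"
  where "irreducible_real_germ X \<longleftrightarrow>
    real_subvariety_germ X \<and> 0 \<in> X \<and>
    (\<forall>A B. real_subvariety_germ A \<and> real_subvariety_germ B \<and> set_germ_eq X (A \<union> B) \<longrightarrow>
       set_germ_eq X A \<or> set_germ_eq X B)"

text \<open>\<open>p\<close> is a regular point of dimension \<open>d\<close>: near \<open>p\<close>, some real-analytic change of coordinates
  maps \<open>X\<close> onto an open piece of a \<open>d\<close>-dimensional real linear subspace.\<close>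

definition regular_point :: "(complex^'n::finite) set \<Rightarrow> nat \<Rightarrow> complex^'n \<Rightarrow> bool"
  where "regular_point X d p \<longleftrightarrow> p \<in> X \<and>
    (\<exists>U (V :: (complex^'n) set) \<phi> \<psi> L. open U \<and> p \<in> U \<and> open V \<and> homeomorphism U V \<phi> \<psi> \<and>
       (\<forall>x\<in>U. \<forall>i. real_analytic_at (\<lambda>z. \<phi> z $ i) x) \<and>
       (\<forall>y\<in>V. \<forall>i. real_analytic_at (\<lambda>z. \<psi> z $ i) y) \<and>
       subspace L \<and> dim L = d \<and> X \<inter> U = {x \<in> U. \<phi> x \<in> L})"

text \<open>The real dimension is the largest dimension of regular points arbitrarily close to \<open>0\<close>.\<close>

definition real_dim_germ :: "(complex^'n::finite) set \<Rightarrow> nat \<Rightarrow> bool"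
  where "real_dim_germ X d \<longleftrightarrow>
    frequently (regular_point X d) (nhds 0) \<and>
    eventually (\<lambda>p. \<forall>e. regular_point X e p \<longrightarrow> e \<le> d) (nhds 0)"

definition real_ideal :: "(complex^'n::finite) set \<Rightarrow> (complex^'n \<Rightarrow> complex) set"
  where "real_ideal X =
    {\<rho>. real_analytic_at \<rho> 0 \<and> eventually (\<lambda>z. z \<in> X \<longrightarrow> \<rho> z = 0) (nhds 0)}"

text \<open>The series \<open>\<rho>(z, \<xi>)\<close> with \<open>\<rho>(z, cnj z)\<close> in the ideal of \<open>X\<close>.\<close>

definition complexified_ideal :: "(complex^'n::finite) set \<Rightarrow> (complex^('n + 'n) \<Rightarrow> complex) set"
  where "complexified_ideal X = {\<rho>. holo_at \<rho> 0 \<and> (\<lambda>z. \<rho> (pt z (vcnj z))) \<in> real_ideal X}"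

definition segre_ideal :: "(complex^'n::finite) set \<Rightarrow> (complex^'n \<Rightarrow> complex) set"
  where "segre_ideal X =
    {h. holo_at h 0 \<and> (\<exists>\<rho>\<in>complexified_ideal X. germ_eq h (\<lambda>z. \<rho> (pt z 0)))}"

definition max_ideal :: "(complex^'n::finite \<Rightarrow> complex) set"
  where "max_ideal = {h. holo_at h 0 \<and> h 0 = 0}"

definition max_ideal_pow :: "nat \<Rightarrow> (complex^'n::finite \<Rightarrow> complex) set"
  where "max_ideal_pow s =
    {\<lambda>z. \<Sum>i<N. c i z * (\<Prod>j<s. u i j z) | (N::nat) c u.
       (\<forall>i<N. holo_at (c i) 0) \<and> (\<forall>i<N. \<forall>j<s. u i j \<in> max_ideal)}"

definition segre_nondegenerate :: "(complex^'n::finite) set \<Rightarrow> bool"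
  where "segre_nondegenerate X \<longleftrightarrow> (\<exists>s. max_ideal_pow s \<subseteq> segre_ideal X)"


section \<open>The complexification and its projection\<close>

definition complex_subvariety :: "(complex^'m::finite) set \<Rightarrow> (complex^'m) set \<Rightarrow> bool"
  where "complex_subvariety W \<Omega> \<longleftrightarrow> W \<subseteq> \<Omega> \<and>
    (\<forall>p\<in>\<Omega>. \<exists>U H. open U \<and> p \<in> U \<and> U \<subseteq> \<Omega> \<and> finite H \<and> (\<forall>h\<in>H. \<forall>x\<in>U. holo_at h x) \<and>
       W \<inter> U = {x \<in> U. \<forall>h\<in>H. h x = 0})"

definition irreducible_subvariety :: "(complex^'m::finite) set \<Rightarrow> (complex^'m) set \<Rightarrow> bool"
  where "irreducible_subvariety W \<Omega> \<longleftrightarrow>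
    complex_subvariety W \<Omega> \<and> W \<noteq> {} \<and>
    (\<forall>A B. complex_subvariety A \<Omega> \<and> complex_subvariety B \<Omega> \<and> W = A \<union> B \<longrightarrow> W = A \<or> W = B)"

definition holo_ideal :: "(complex^'m::finite) set \<Rightarrow> (complex^'m \<Rightarrow> complex) set"
  where "holo_ideal W = {h. holo_at h 0 \<and> eventually (\<lambda>x. x \<in> W \<longrightarrow> h x = 0) (nhds 0)}"

definition fiber :: "(complex^('n + 'n)) set \<Rightarrow> complex^'n \<Rightarrow> (complex^'n) set"
  where "fiber W z = {\<zeta>. pt z \<zeta> \<in> W}"

text \<open>The multiplicity of the point \<open>(z, \<zeta>)\<close> in its fiber is the number of points close to \<open>\<zeta>\<close> in
  a generic fiber close to that of \<open>z\<close>, i.e. the upper limit of the number of points of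
  \<open>fiber W z'\<close> in a small ball around \<open>\<zeta>\<close> as \<open>z'\<close> tends to \<open>z\<close>.\<close>

definition fiber_mult :: "(complex^('n::finite + 'n)) set \<Rightarrow> complex^'n \<Rightarrow> complex^'n \<Rightarrow> nat"
  where "fiber_mult W z \<zeta> = (THE m. \<exists>\<epsilon>\<^sub>0>0. \<forall>\<epsilon>. 0 < \<epsilon> \<and> \<epsilon> \<le> \<epsilon>\<^sub>0 \<longrightarrow>
     eventually (\<lambda>z'. card (fiber W z' \<inter> ball \<zeta> \<epsilon>) \<le> m) (nhds z) \<and>
     frequently (\<lambda>z'. card (fiber W z' \<inter> ball \<zeta> \<epsilon>) = m) (nhds z))"

text \<open>Outside a nowhere dense complex subvariety \<open>E\<close> of \<open>D\<close>, the set \<open>W\<close> consists locally over \<open>D\<close>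
  of the graphs of \<open>k\<close> holomorphic maps with pairwise distinct values: the points of the fibers are
  generically distinct.\<close>

definition generically_k_sheeted ::
    "(complex^('n::finite + 'n)) set \<Rightarrow> (complex^'n) set \<Rightarrow> nat \<Rightarrow> bool"
  where "generically_k_sheeted W D k \<longleftrightarrow>
    (\<exists>E. complex_subvariety E D \<and> interior E = {} \<and>
      (\<forall>p\<in>D - E. \<exists>U \<sigma>. open U \<and> p \<in> U \<and> U \<subseteq> D \<and>
         (\<forall>j\<in>{1..k}. \<forall>x\<in>U. \<forall>i. holo_at (\<lambda>z. \<sigma> j z $ i) x) \<and>
         (\<forall>z\<in>U. inj_on (\<lambda>j. \<sigma> j z) {1..k} \<and> fiber W z = (\<lambda>j. \<sigma> j z) ` {1..k})))"

text \<open>\<open>W\<close> represents the complexification of \<open>(X, 0)\<close> in the polydisc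
  \<open>\<Delta>\<^sub>z \<times> \<Delta>\<^sub>\<xi>\<close> with polyradii \<open>r\<close> and \<open>s\<close>, and projects finitely onto \<open>\<Delta>\<^sub>z\<close>, with \<open>k\<close> points in
  each fiber.\<close>

definition segre_representative ::
    "(complex^'n::finite) set \<Rightarrow> nat \<Rightarrow> ('n \<Rightarrow> real) \<Rightarrow> ('n \<Rightarrow> real) \<Rightarrow> (complex^('n + 'n)) set \<Rightarrow> bool"
  where "segre_representative X k r s W \<longleftrightarrow>
    (\<forall>i. 0 < r i \<and> 0 < s i) \<and>
    irreducible_subvariety W (polydisc (case_sum r s)) \<and>
    holo_ideal W = complexified_ideal X \<and>
    proper_map (top_of_set W) (top_of_set (polydisc r)) proj1 \<and>
    (\<forall>z\<in>polydisc r. finite (fiber W z)) \<and>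
    fiber W 0 = {0} \<and>
    generically_k_sheeted W (polydisc r) k \<and>
    (\<forall>z\<in>polydisc r. (\<Sum>\<zeta>\<in>fiber W z. fiber_mult W z \<zeta>) = k)"

definition segre_multiplicity :: "(complex^'n::finite) set \<Rightarrow> nat \<Rightarrow> bool"
  where "segre_multiplicity X k \<longleftrightarrow>
    (\<forall>\<epsilon>>0. \<exists>r s W. (\<forall>i. r i < \<epsilon> \<and> s i < \<epsilon>) \<and> segre_representative X k r s W)"

text \<open>The points \<open>\<xi> 1 z, \<dots>, \<xi> k z\<close> of the fibers, repeated according to multiplicity, in
  any order.\<close>

definition fiber_enumeration ::
    "(complex^('n::finite + 'n)) set \<Rightarrow> (complex^'n) set \<Rightarrow> nat \<Rightarrow> (nat \<Rightarrow> complex^'n \<Rightarrow> complex^'n) \<Rightarrow> bool"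
  where "fiber_enumeration W D k \<xi> \<longleftrightarrow>
    (\<forall>z\<in>D. fiber W z = (\<lambda>j. \<xi> j z) ` {1..k} \<and>
       (\<forall>\<zeta>\<in>fiber W z. card {j \<in> {1..k}. \<xi> j z = \<zeta>} = fiber_mult W z \<zeta>))"

text \<open>\<open>A\<close> operates on germs, and so is determined only up to equality of germs, and only on
  real-analytic germs.\<close>

definition averaging_operator ::
    "(complex^'n::finite) set \<Rightarrow> nat \<Rightarrow> ((complex^'n \<Rightarrow> complex) \<Rightarrow> complex^'n \<Rightarrow> complex) \<Rightarrow> bool"
  where "averaging_operator X k A \<longleftrightarrow>
    (\<exists>r s W \<xi>. segre_representative X k r s W \<and> fiber_enumeration W (polydisc r) k \<xi> \<and>
      (\<forall>f. real_analytic_at f 0 \<longrightarrow>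
         germ_eq (A f) (\<lambda>z. (1 / of_nat k) * (\<Sum>j=1..k. complexify f (pt z (\<xi> j z))))))"

end

theory Submission
  imports Defs "HOL-Complex_Analysis.Conformal_Mappings"
begin

text \<open>
  Let \<open>F(z, \<xi>)\<close> be the complexification of \<open>f\<close>, and let \<open>W\<close> represent the complexification of \<open>X\<close>, with fibers
  \<open>{\<xi> 1 z, \<dots>, \<xi> k z}\<close> over \<open>z\<close>. Both conditions of the theorem say that \<open>F\<close> is constant on the fibers of \<open>W\<close>
  near \<open>0\<close>.

  If \<open>f = g\<close> on \<open>X\<close> with \<open>g\<close> holomorphic, then \<open>F(z, \<xi>) - g(z)\<close> belongs to the complexified ideal of \<open>X\<close>, which is the
  ideal of \<open>W\<close>. So \<open>F(z, \<xi> j z) = g(z)\<close> for all \<open>j\<close>, every average of \<open>f ^ l\<close> is \<open>g ^ l\<close>, and the identities follow.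

  Conversely, the identities say that the first \<open>k\<close> power sums of the \<open>k\<close> numbers \<open>F(z, \<xi> j z)\<close> agree with those of
  \<open>k\<close> copies of their mean \<open>A f z\<close>; hence all these numbers are equal to \<open>A f z\<close> (\<open>all_equal_if_power_sums_equal\<close>).
  A function that is constant on the fibers descends to a holomorphic function of \<open>z\<close>
  (\<open>holo_at_fiber_constant\<close>), so \<open>A f\<close> is holomorphic, and it agrees with \<open>f\<close> on \<open>X\<close> because \<open>(z, cnj z)\<close> lies on \<open>W\<close>
  for \<open>z\<close> in \<open>X\<close>.

  The analytic input is basic function theory of several variables. Holomorphy in the sense of
  convergent power series is shown to be equivalent to continuity together with holomorphy along every
  holomorphic curve (\<open>holo_at_iff_curve_holo\<close>, a form of Osgood's lemma). In the second form, composition, the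
  uniqueness of complexifications (\<open>germ_eq_complexification_unique\<close>) and the extension of continuous functions
  over the branch locus (\<open>curve_holo_extends_over_zero_set\<close>) reduce to one complex variable.
\<close>

section \<open>Functions that are holomorphic along holomorphic curves\<close>

text \<open>Polydiscs with equal radii about an arbitrary centre: the domains on which the series in
  \<^const>\<open>holo_at\<close> converge.\<close>

definition polycyl :: "complex^'m \<Rightarrow> real \<Rightarrow> (complex^'m) set"
  where "polycyl p r = {x. \<forall>i. cmod (x $ i - p $ i) < r}"

text \<open>A working definition of holomorphy in several variables that is visibly closed under composition
  and under uniform limits, since along a curve everything reduces to one complex variable. It is
  equivalent to local expansion in power series (\<open>holo_at_iff_curve_holo\<close>).\<close>

definition curve_holo :: "(complex^'m::finite \<Rightarrow> complex) \<Rightarrow> (complex^'m) set \<Rightarrow> bool"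
  where "curve_holo F U \<longleftrightarrow> continuous_on U F \<and>
    (\<forall>\<gamma> S. open S \<longrightarrow> (\<forall>i. (\<lambda>t. \<gamma> t $ i) holomorphic_on S) \<longrightarrow> \<gamma> ` S \<subseteq> U \<longrightarrow>
       (\<lambda>t. F (\<gamma> t)) holomorphic_on S)"

lemma open_polycyl [simp]: "open (polycyl p r :: (complex^'m::finite) set)"
proof -
  have "polycyl p r = (\<Inter>i\<in>UNIV. {x :: complex^'m. cmod (x $ i - p $ i) < r})"
    by (auto simp: polycyl_def)
  moreover have "open {x :: complex^'m. cmod (x $ i - p $ i) < r}" for i
    by (intro open_Collect_less continuous_intros)
  ultimately show ?thesis
    using open_INT[of UNIV "\<lambda>i. {x :: complex^'m. cmod (x $ i - p $ i) < r}"] by simp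
qed

lemma center_in_polycyl [simp]: "0 < r \<Longrightarrow> p \<in> polycyl p r"
  by (simp add: polycyl_def)

lemma polycyl_mono: "r \<le> r' \<Longrightarrow> polycyl p r \<subseteq> polycyl p r'"
  by (auto simp: polycyl_def intro: less_le_trans)

lemma polycyl_add_iff [simp]: "p + x \<in> polycyl p r \<longleftrightarrow> x \<in> polycyl 0 r"
  by (simp add: polycyl_def)

lemma open_contains_polycyl:
  fixes p :: "complex^'m::finite"
  assumes "open U" "p \<in> U"
  obtains r where "0 < r" "polycyl p r \<subseteq> U"
proof -
  obtain e where e: "e > 0" "ball p e \<subseteq> U"
    using assms open_contains_ball by blast
  have "polycyl p (e / CARD('m)) \<subseteq> ball p e"
  proof
    fix x assume x: "x \<in> polycyl p (e / CARD('m))"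
    have "norm (x - p) \<le> (\<Sum>i\<in>UNIV. cmod ((x - p) $ i))"
      unfolding norm_vec_def by (intro L2_set_le_sum) auto
    also have "\<dots> < (\<Sum>i\<in>(UNIV::'m set). e / CARD('m))"
      using x by (intro sum_strict_mono) (auto simp: polycyl_def)
    also have "\<dots> = e" by simp
    finally show "x \<in> ball p e" by (simp add: dist_norm norm_minus_commute)
  qed
  with e show ?thesis by (intro that[of "e / CARD('m)"]) auto
qed

lemma eventually_nhds_polycyl:
  fixes p :: "complex^'m::finite"
  shows "eventually P (nhds p) \<longleftrightarrow> (\<exists>r>0. \<forall>x\<in>polycyl p r. P x)"
proof
  assume "eventually P (nhds p)"
  then obtain U where "open U" "p \<in> U" "\<forall>x\<in>U. P x" by (auto simp: eventually_nhds)
  then show "\<exists>r>0. \<forall>x\<in>polycyl p r. P x" by (meson open_contains_polycyl subsetD)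
next
  assume "\<exists>r>0. \<forall>x\<in>polycyl p r. P x"
  then show "eventually P (nhds p)"
    unfolding eventually_nhds by (meson center_in_polycyl open_polycyl)
qed

lemma continuous_on_curve:
  assumes "\<forall>i. (\<lambda>t. \<gamma> t $ i) holomorphic_on S"
  shows "continuous_on S (\<gamma> :: complex \<Rightarrow> complex^'m::finite)"
proof -
  have "continuous_on S (\<lambda>t. \<chi> i. \<gamma> t $ i)"
    using assms by (intro continuous_on_vec_lambda) (auto intro: holomorphic_on_imp_continuous_on)
  then show ?thesis by simp
qed

lemma curve_holo_continuous: "curve_holo F U \<Longrightarrow> continuous_on U F"
  by (simp add: curve_holo_def)

lemma curve_holo_along:
  "\<lbrakk>curve_holo F U; open S; \<And>i. (\<lambda>t. \<gamma> t $ i) holomorphic_on S; \<And>t. t \<in> S \<Longrightarrow> \<gamma> t \<in> U\<rbrakk>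
   \<Longrightarrow> (\<lambda>t. F (\<gamma> t)) holomorphic_on S"
  unfolding curve_holo_def by (metis image_subsetI)

lemma curve_holo_subset: "\<lbrakk>curve_holo F U; V \<subseteq> U\<rbrakk> \<Longrightarrow> curve_holo F V"
  by (auto simp: curve_holo_def intro: continuous_on_subset)

lemma curve_holo_cong: "\<lbrakk>curve_holo F U; \<And>x. x \<in> U \<Longrightarrow> F x = G x\<rbrakk> \<Longrightarrow> curve_holo G U"
  unfolding curve_holo_def
  by (smt (verit, best) continuous_on_eq holomorphic_transform image_subset_iff)

lemma curve_holo_const [intro]: "curve_holo (\<lambda>x. c) U"
  and curve_holo_component [intro]: "curve_holo (\<lambda>x. x $ i) U"
  by (auto simp: curve_holo_def intro!: continuous_intros)

lemma curve_holo_add: "\<lbrakk>curve_holo F U; curve_holo G U\<rbrakk> \<Longrightarrow> curve_holo (\<lambda>x. F x + G x) U"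
  and curve_holo_diff: "\<lbrakk>curve_holo F U; curve_holo G U\<rbrakk> \<Longrightarrow> curve_holo (\<lambda>x. F x - G x) U"
  and curve_holo_mult: "\<lbrakk>curve_holo F U; curve_holo G U\<rbrakk> \<Longrightarrow> curve_holo (\<lambda>x. F x * G x) U"
  and curve_holo_power: "curve_holo F U \<Longrightarrow> curve_holo (\<lambda>x. F x ^ n) U"
  by (auto simp: curve_holo_def intro!: continuous_intros holomorphic_intros)

lemma curve_holo_sum: "(\<And>a. a \<in> B \<Longrightarrow> curve_holo (F a) U) \<Longrightarrow> curve_holo (\<lambda>x. \<Sum>a\<in>B. F a x) U"
  and curve_holo_prod: "(\<And>a. a \<in> B \<Longrightarrow> curve_holo (F a) U) \<Longrightarrow> curve_holo (\<lambda>x. \<Prod>a\<in>B. F a x) U"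
  by (induction B rule: infinite_finite_induct) (auto intro: curve_holo_add curve_holo_mult)

lemma curve_holo_compose:
  fixes \<phi> :: "complex^'m::finite \<Rightarrow> complex^'k::finite"
  assumes F: "curve_holo F V" and \<phi>: "\<And>i. curve_holo (\<lambda>x. \<phi> x $ i) U" and sub: "\<And>x. x \<in> U \<Longrightarrow> \<phi> x \<in> V"
  shows "curve_holo (\<lambda>x. F (\<phi> x)) U"
  unfolding curve_holo_def
proof (intro conjI allI impI)
  have "continuous_on U (\<lambda>x. \<chi> i. \<phi> x $ i)"
    using \<phi> by (intro continuous_on_vec_lambda) (auto intro: curve_holo_continuous)
  then show "continuous_on U (\<lambda>x. F (\<phi> x))"
    using sub by (intro continuous_on_compose2[OF curve_holo_continuous[OF F]]) auto
next
  fix \<gamma> :: "complex \<Rightarrow> complex^'m" and S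
  assume "open S" "\<forall>i. (\<lambda>t. \<gamma> t $ i) holomorphic_on S" "\<gamma> ` S \<subseteq> U"
  then show "(\<lambda>t. F (\<phi> (\<gamma> t))) holomorphic_on S"
    using sub by (intro curve_holo_along[OF F] curve_holo_along[OF \<phi>]) auto
qed

lemma curve_holo_local:
  fixes F :: "complex^'m::finite \<Rightarrow> complex"
  assumes "\<And>p. p \<in> U \<Longrightarrow> \<exists>V. open V \<and> p \<in> V \<and> curve_holo F V"
  shows "curve_holo F U"
  unfolding curve_holo_def
proof (intro conjI allI impI)
  show "continuous_on U F"
  proof (rule continuous_at_imp_continuous_on, rule ballI)
    fix p assume "p \<in> U"
    then obtain V where "open V" "p \<in> V" "curve_holo F V" using assms by blast
    then show "isCont F p"
      using curve_holo_continuous continuous_on_eq_continuous_at by blast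
  qed
next
  fix \<gamma> :: "complex \<Rightarrow> complex^'m" and S
  assume S: "open S" and \<gamma>: "\<forall>i. (\<lambda>t. \<gamma> t $ i) holomorphic_on S" "\<gamma> ` S \<subseteq> U"
  have "(\<lambda>t. F (\<gamma> t)) field_differentiable at t within S" if t: "t \<in> S" for t
  proof -
    obtain V where V: "open V" "\<gamma> t \<in> V" "curve_holo F V" using assms \<gamma> t by blast
    define T where "T = S \<inter> \<gamma> -` V"
    have T: "open T" "t \<in> T"
      using continuous_on_curve[OF \<gamma>(1)] S V t
      by (auto simp: T_def continuous_on_open_vimage Int_commute)
    have "(\<lambda>t. F (\<gamma> t)) holomorphic_on T"
      using \<gamma>(1) by (intro curve_holo_along[OF V(3) T(1)]) (auto simp: T_def intro: holomorphic_on_subset)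
    then show ?thesis
      using T holomorphic_on_imp_differentiable_at field_differentiable_at_within by blast
  qed
  then show "(\<lambda>t. F (\<gamma> t)) holomorphic_on S" by (auto simp: holomorphic_on_def)
qed

lemma curve_holo_uniform_limit:
  fixes F :: "complex^'m::finite \<Rightarrow> complex"
  assumes G: "\<And>A. curve_holo (G A) U" and lim: "uniform_limit U G F net" and net: "\<not> trivial_limit net"
  shows "curve_holo F U"
  unfolding curve_holo_def
proof (intro conjI allI impI)
  show "continuous_on U F"
    using G by (intro uniform_limit_theorem[OF _ lim net]) (auto simp: curve_holo_continuous)
next
  fix \<gamma> :: "complex \<Rightarrow> complex^'m" and S
  assume S: "open S" and \<gamma>: "\<forall>i. (\<lambda>t. \<gamma> t $ i) holomorphic_on S" "\<gamma> ` S \<subseteq> U"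
  have hol: "(\<lambda>t. G A (\<gamma> t)) holomorphic_on S" for A
    using \<gamma> S by (intro curve_holo_along[OF G]) auto
  have "(\<lambda>t. F (\<gamma> t)) field_differentiable at t within S" if t: "t \<in> S" for t
  proof -
    obtain e where e: "e > 0" "cball t e \<subseteq> S" using S t open_contains_cball by blast
    have "uniform_limit (cball t e) (\<lambda>A s. G A (\<gamma> s)) (\<lambda>s. F (\<gamma> s)) net"
      using \<gamma> e by (intro uniform_limit_compose'[OF lim]) auto
    moreover have "\<forall>\<^sub>F A in net. continuous_on (cball t e) (\<lambda>s. G A (\<gamma> s)) \<and> (\<lambda>s. G A (\<gamma> s)) holomorphic_on ball t e"
      using hol e by (intro always_eventually allI conjI)
        (meson holomorphic_on_imp_continuous_on holomorphic_on_subset ball_subset_cball order_trans)+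
    ultimately have "(\<lambda>s. F (\<gamma> s)) holomorphic_on ball t e"
      using holomorphic_uniform_limit[OF _ _ net, of t e "\<lambda>A s. G A (\<gamma> s)" "\<lambda>s. F (\<gamma> s)"] by blast
    then show ?thesis
      using e(1) holomorphic_on_imp_differentiable_at field_differentiable_at_within
      by (metis centre_in_ball open_ball)
  qed
  then show "(\<lambda>t. F (\<gamma> t)) holomorphic_on S" by (auto simp: holomorphic_on_def)
qed

text \<open>A series that converges at \<open>p + (q, \<dots>, q)\<close> converges absolutely there, and its terms at this point
  dominate those on the polydisc of radius \<open>q\<close>; so the finite partial sums, which are polynomials,
  converge uniformly.\<close>

lemma holo_at_imp_curve_holo:
  fixes F :: "complex^'m::finite \<Rightarrow> complex"
  assumes "holo_at F p"
  obtains r where "0 < r" "curve_holo F (polycyl p r)"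
proof -
  obtain c r where r: "0 < r"
    and sum: "\<And>x. (\<forall>i. cmod (x $ i - p $ i) < r) \<Longrightarrow> ((\<lambda>\<alpha>. c \<alpha> * monomial \<alpha> (x - p)) has_sum F x) UNIV"
    using assms unfolding holo_at_def by blast
  define q where "q = r / 2"
  define P where "P = p + (\<chi> i. of_real q)"
  have q: "0 < q" "q < r" using r by (auto simp: q_def)
  have "((\<lambda>\<alpha>. c \<alpha> * monomial \<alpha> (P - p)) has_sum F P) UNIV"
    using q by (intro sum) (auto simp: P_def)
  then have M: "(\<lambda>\<alpha>. cmod (c \<alpha> * monomial \<alpha> (P - p))) summable_on UNIV"
    by (intro summable_on_iff_abs_summable_on_complex[THEN iffD1] has_sum_imp_summable)
  have "uniform_limit (polycyl p q) (\<lambda>B x. \<Sum>\<alpha>\<in>B. c \<alpha> * monomial \<alpha> (x - p)) F (finite_subsets_at_top UNIV)"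
  proof (rule Weierstrass_m_test_general'[OF _ _ M])
    fix \<alpha> x assume x: "x \<in> polycyl p q"
    show "cmod (c \<alpha> * monomial \<alpha> (x - p)) \<le> cmod (c \<alpha> * monomial \<alpha> (P - p))"
      using x q unfolding norm_mult monomial_def P_def polycyl_def
      by (auto simp: prod_norm[symmetric] norm_power less_imp_le intro!: mult_left_mono prod_mono power_mono)
  next
    fix x assume "x \<in> polycyl p q"
    then show "((\<lambda>\<alpha>. c \<alpha> * monomial \<alpha> (x - p)) has_sum F x) UNIV"
      using q by (intro sum) (auto simp: polycyl_def intro: less_trans)
  qed
  then have "curve_holo F (polycyl p q)"
  proof (rule curve_holo_uniform_limit[rotated])
    show "curve_holo (\<lambda>x. \<Sum>\<alpha>\<in>B. c \<alpha> * monomial \<alpha> (x - p)) (polycyl p q)" for B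
      unfolding monomial_def
      by (auto intro!: curve_holo_sum curve_holo_mult curve_holo_prod curve_holo_power curve_holo_diff)
  qed simp
  with q that show ?thesis by blast
qed

section \<open>Integrals depending on a parameter\<close>

text \<open>By Fubini, integrating the parameter integral over a triangle in \<open>S\<close> amounts to integrating over the
  circle the triangle integrals of \<open>H\<close>, which all vanish by Cauchy's theorem; Morera's theorem concludes.\<close>

lemma holomorphic_contour_integral_parameter:
  fixes H :: "complex \<Rightarrow> complex \<Rightarrow> complex"
  assumes S: "open S" and \<rho>: "0 < \<rho>"
    and cont: "continuous_on (S \<times> sphere 0 \<rho>) (\<lambda>(s, \<zeta>). H s \<zeta>)"
    and hol: "\<And>\<zeta>. \<zeta> \<in> sphere 0 \<rho> \<Longrightarrow> (\<lambda>s. H s \<zeta>) holomorphic_on S"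
    and contI: "continuous_on S (\<lambda>s. contour_integral (circlepath 0 \<rho>) (H s))"
  shows "(\<lambda>s. contour_integral (circlepath 0 \<rho>) (H s)) holomorphic_on S"
proof (rule analytic_imp_holomorphic, rule Morera_local_triangle)
  fix z assume "z \<in> S"
  define I where "I = (\<lambda>s. contour_integral (circlepath 0 \<rho>) (H s))"
  have vec_circ: "continuous_on {0..1} (\<lambda>t. vector_derivative (circlepath 0 \<rho>) (at t))"
    unfolding vector_derivative_circlepath by (intro continuous_intros)
  define J where "J = (\<lambda>a b \<zeta>. contour_integral (linepath a b) (\<lambda>s. H s \<zeta>))"
  have swap: "contour_integral (linepath a b) I = contour_integral (circlepath 0 \<rho>) (J a b)"
    if "closed_segment a b \<subseteq> S" for a b
    unfolding I_def J_def
    by (rule contour_integral_swap)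
       (use that \<rho> vec_circ in \<open>auto intro: continuous_on_subset[OF cont]\<close>)
  have "contour_integral (linepath a b) I + contour_integral (linepath b c) I +
        contour_integral (linepath c a) I = 0" if abc: "convex hull {a,b,c} \<subseteq> S" for a b c
  proof -
    have seg: "closed_segment a b \<subseteq> S" "closed_segment b c \<subseteq> S" "closed_segment c a \<subseteq> S"
      using abc by (auto simp: segment_convex_hull dest!: subsetD[OF hull_mono[of "{_,_}" "{a,b,c}"], rotated])
    have J: "J a b contour_integrable_on circlepath 0 \<rho>" if "closed_segment a b \<subseteq> S" for a b
    proof (rule contour_integrable_continuous_circlepath)
      have "continuous_on (sphere 0 \<rho>) (\<lambda>\<zeta>. integral {0..1} (\<lambda>x. H (linepath a b x) \<zeta> * (b - a)))"
        unfolding cbox_interval[symmetric]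
      proof (rule integral_continuous_on_param)
        have lin: "continuous_on (sphere 0 \<rho> \<times> cbox 0 1) (\<lambda>w. linepath a b (snd w))"
          unfolding linepath_def by (intro continuous_intros)
        have "continuous_on (sphere 0 \<rho> \<times> cbox 0 1) (\<lambda>w. case (linepath a b (snd w), fst w) of (s, \<zeta>) \<Rightarrow> H s \<zeta>)"
          using that by (intro continuous_on_compose2[OF cont] continuous_intros lin)
            (auto simp: path_image_linepath[symmetric] path_image_def)
        then show "continuous_on (sphere 0 \<rho> \<times> cbox 0 1) (\<lambda>(\<zeta>, x). H (linepath a b x) \<zeta> * (b - a))"
          by (auto simp: case_prod_unfold intro: continuous_intros)
      qed
      then show "continuous_on (path_image (circlepath 0 \<rho>)) (J a b)"
        using \<rho> by (simp add: J_def contour_integral_integral)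
    qed
    have zero: "J a b \<zeta> + J b c \<zeta> + J c a \<zeta> = 0" if \<zeta>: "\<zeta> \<in> sphere 0 \<rho>" for \<zeta>
    proof -
      have hol': "(\<lambda>s. H s \<zeta>) holomorphic_on convex hull {a,b,c}"
        using hol[OF \<zeta>] abc holomorphic_on_subset by blast
      have int: "(\<lambda>s. H s \<zeta>) contour_integrable_on linepath x y" if "closed_segment x y \<subseteq> S" for x y
        using hol[OF \<zeta>] that
        by (intro contour_integrable_continuous_linepath) (meson holomorphic_on_imp_continuous_on holomorphic_on_subset)
      have "((\<lambda>s. H s \<zeta>) has_contour_integral 0) (linepath a b +++ linepath b c +++ linepath c a)"
        using Cauchy_theorem_triangle[OF hol'] .
      moreover have "((\<lambda>s. H s \<zeta>) has_contour_integral (J a b \<zeta> + (J b c \<zeta> + J c a \<zeta>)))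
          (linepath a b +++ linepath b c +++ linepath c a)"
        unfolding J_def using int seg
        by (intro has_contour_integral_join has_contour_integral_integral valid_path_join) auto
      ultimately show ?thesis
        using has_contour_integral_unique by (metis add.assoc)
    qed
    have "contour_integral (linepath a b) I + contour_integral (linepath b c) I + contour_integral (linepath c a) I =
          contour_integral (circlepath 0 \<rho>) (\<lambda>\<zeta>. J a b \<zeta> + J b c \<zeta> + J c a \<zeta>)"
      using seg J by (simp add: swap contour_integral_add contour_integrable_add)
    also have "\<dots> = contour_integral (circlepath 0 \<rho>) (\<lambda>\<zeta>. 0)"
      using zero \<rho> by (intro contour_integral_cong) auto
    finally show ?thesis by simp
  qed
  with S \<open>z \<in> S\<close> contI show "\<exists>t. open t \<and> z \<in> t \<and> continuous_on t I \<and>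
     (\<forall>a b c. convex hull {a,b,c} \<subseteq> t \<longrightarrow> contour_integral (linepath a b) I +
        contour_integral (linepath b c) I + contour_integral (linepath c a) I = 0)"
    unfolding I_def by blast
qed

lemma curve_holo_contour_integral:
  fixes G :: "complex^'m::finite \<Rightarrow> complex \<Rightarrow> complex"
  assumes \<rho>: "0 < \<rho>"
    and cont: "continuous_on (U \<times> sphere 0 \<rho>) (\<lambda>(x, \<zeta>). G x \<zeta>)"
    and hol: "\<And>\<zeta>. \<zeta> \<in> sphere 0 \<rho> \<Longrightarrow> curve_holo (\<lambda>x. G x \<zeta>) U"
  shows "curve_holo (\<lambda>x. contour_integral (circlepath 0 \<rho>) (G x)) U"
  unfolding curve_holo_def
proof (intro conjI allI impI)
  have sph: "\<rho> * exp (2 * of_real pi * \<i> * of_real t) \<in> sphere 0 \<rho>" for t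
    using \<rho> by (simp add: norm_mult)
  have "continuous_on U (\<lambda>x. integral {0..1} (\<lambda>t. G x (circlepath 0 \<rho> t) *
           vector_derivative (circlepath 0 \<rho>) (at t)))"
    unfolding cbox_interval[symmetric]
  proof (rule integral_continuous_on_param)
    have "continuous_on (U \<times> cbox 0 1) (\<lambda>w. case (fst w, circlepath 0 \<rho> (snd w)) of (x, \<zeta>) \<Rightarrow> G x \<zeta>)"
      using sph unfolding circlepath
      by (intro continuous_on_compose2[OF cont] continuous_intros) auto
    then show "continuous_on (U \<times> cbox 0 1) (\<lambda>(x, t). G x (circlepath 0 \<rho> t) *
           vector_derivative (circlepath 0 \<rho>) (at t))"
      unfolding vector_derivative_circlepath case_prod_unfold
      by (intro continuous_intros) simp
  qed
  then show contI: "continuous_on U (\<lambda>x. contour_integral (circlepath 0 \<rho>) (G x))"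
    by (simp add: contour_integral_integral)
  fix \<gamma> :: "complex \<Rightarrow> complex^'m" and S
  assume S: "open S" and \<gamma>: "\<forall>i. (\<lambda>t. \<gamma> t $ i) holomorphic_on S" "\<gamma> ` S \<subseteq> U"
  have cont\<gamma>: "continuous_on S \<gamma>" using continuous_on_curve \<gamma>(1) by blast
  show "(\<lambda>t. contour_integral (circlepath 0 \<rho>) (G (\<gamma> t))) holomorphic_on S"
  proof (rule holomorphic_contour_integral_parameter[OF S \<rho>])
    have "continuous_on (S \<times> sphere 0 \<rho>) (\<lambda>w. case (\<gamma> (fst w), snd w) of (x, \<zeta>) \<Rightarrow> G x \<zeta>)"
      using \<gamma>(2) by (intro continuous_on_compose2[OF cont] continuous_intros continuous_on_compose2[OF cont\<gamma>]) auto
    then show "continuous_on (S \<times> sphere 0 \<rho>) (\<lambda>(s, \<zeta>). G (\<gamma> s) \<zeta>)"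
      by (simp add: case_prod_unfold)
    show "(\<lambda>s. G (\<gamma> s) \<zeta>) holomorphic_on S" if "\<zeta> \<in> sphere 0 \<rho>" for \<zeta>
      using \<gamma> S by (intro curve_holo_along[OF hol[OF that]]) auto
    show "continuous_on S (\<lambda>s. contour_integral (circlepath 0 \<rho>) (G (\<gamma> s)))"
      using \<gamma>(2) by (intro continuous_on_compose2[OF contI cont\<gamma>])
  qed
qed

section \<open>Power series expansion in several variables\<close>

definition set_coord :: "'m \<Rightarrow> complex \<Rightarrow> complex^'m \<Rightarrow> complex^'m"
  where "set_coord j \<zeta> x = (\<chi> i. if i = j then \<zeta> else x $ i)"

definition closed_polycyl :: "real \<Rightarrow> (complex^'m) set"
  where "closed_polycyl \<rho> = {x. \<forall>i. cmod (x $ i) \<le> \<rho>}"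

text \<open>The \<open>n\<close>-th Taylor coefficient of \<open>F\<close> in the variable \<open>j\<close> alone, at \<open>0\<close>, as a function of the remaining
  variables. Written as a Cauchy integral it is manifestly holomorphic in those variables.\<close>

definition cauchy_coeff :: "real \<Rightarrow> 'm \<Rightarrow> nat \<Rightarrow> (complex^'m \<Rightarrow> complex) \<Rightarrow> complex^'m \<Rightarrow> complex"
  where "cauchy_coeff \<rho> j n F x =
    1 / (2 * of_real pi * \<i>) * contour_integral (circlepath 0 \<rho>) (\<lambda>\<zeta>. F (set_coord j \<zeta> x) / \<zeta> ^ Suc n)"

lemma set_coord_nth [simp]: "set_coord j \<zeta> x $ i = (if i = j then \<zeta> else x $ i)"
  by (simp add: set_coord_def)

lemma set_coord_same [simp]: "set_coord j (x $ j) x = x"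
  by (simp add: vec_eq_iff)

lemma continuous_on_set_coord: "continuous_on A (\<lambda>w :: (complex^'m::finite) \<times> complex. set_coord j (snd w) (fst w))"
  unfolding set_coord_def
proof (rule continuous_on_vec_lambda)
  fix i show "continuous_on A (\<lambda>w :: (complex^'m::finite) \<times> complex. if i = j then snd w else fst w $ i)"
    by (cases "i = j") (auto intro!: continuous_intros)
qed

lemma curve_holo_cauchy_coeff:
  assumes F: "curve_holo F (polycyl 0 R)" and \<rho>: "0 < \<rho>" "\<rho> < R"
  shows "curve_holo (cauchy_coeff \<rho> j n F) (polycyl 0 R)"
proof -
  have up: "set_coord j \<zeta> x \<in> polycyl 0 R" if "x \<in> polycyl 0 R" "cmod \<zeta> = \<rho>" for x \<zeta>
    using that \<rho> by (auto simp: polycyl_def)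
  have "curve_holo (\<lambda>x. contour_integral (circlepath 0 \<rho>) (\<lambda>\<zeta>. F (set_coord j \<zeta> x) / \<zeta> ^ Suc n)) (polycyl 0 R)"
  proof (rule curve_holo_contour_integral[OF \<rho>(1)])
    show "continuous_on (polycyl 0 R \<times> sphere 0 \<rho>) (\<lambda>(x, \<zeta>). F (set_coord j \<zeta> x) / \<zeta> ^ Suc n)"
      unfolding case_prod_unfold using \<rho> up
      by (intro continuous_intros continuous_on_compose2[OF curve_holo_continuous[OF F] continuous_on_set_coord]) auto
  next
    fix \<zeta> :: complex assume \<zeta>: "\<zeta> \<in> sphere 0 \<rho>"
    have "curve_holo (\<lambda>x. F (set_coord j \<zeta> x)) (polycyl 0 R)"
    proof (rule curve_holo_compose[OF F])
      fix i show "curve_holo (\<lambda>x. set_coord j \<zeta> x $ i) (polycyl 0 R)"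
        by (cases "i = j") auto
    qed (use \<zeta> up in auto)
    then show "curve_holo (\<lambda>x. F (set_coord j \<zeta> x) / \<zeta> ^ Suc n) (polycyl 0 R)"
      unfolding divide_inverse by (intro curve_holo_mult) auto
  qed
  then show ?thesis
    unfolding cauchy_coeff_def by (intro curve_holo_mult) auto
qed

lemma
  assumes F: "curve_holo F (polycyl 0 R)" and \<rho>: "0 < \<rho>" "\<rho> < R" and x: "x \<in> polycyl 0 R"
  shows norm_cauchy_coeff_le:
      "\<lbrakk>\<And>y. y \<in> closed_polycyl \<rho> \<Longrightarrow> cmod (F y) \<le> M; x \<in> closed_polycyl \<rho>\<rbrakk>
       \<Longrightarrow> cmod (cauchy_coeff \<rho> j n F x) \<le> M / \<rho> ^ n"
    and cauchy_coeff_sums: "cmod (x $ j) < \<rho> \<Longrightarrow> (\<lambda>n. cauchy_coeff \<rho> j n F x * x $ j ^ n) sums F x"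
proof -
  define g where "g = (\<lambda>\<zeta>. F (set_coord j \<zeta> x))"
  have "g holomorphic_on ball 0 R"
    unfolding g_def
  proof (rule curve_holo_along[OF F])
    fix i show "(\<lambda>t. set_coord j t x $ i) holomorphic_on ball 0 R"
      by (cases "i = j") (auto intro!: holomorphic_intros)
  qed (use x in \<open>auto simp: polycyl_def\<close>)
  then have hol: "g holomorphic_on cball 0 \<rho>"
    using \<rho> by (auto intro: holomorphic_on_subset)
  have hol': "g holomorphic_on ball 0 \<rho>"
    using hol by (auto intro: holomorphic_on_subset)
  have int: "((\<lambda>u. g u / u ^ Suc n) has_contour_integral (2 * pi * \<i> / fact n * (deriv ^^ n) g 0)) (circlepath 0 \<rho>)" for n
    using Cauchy_has_contour_integral_higher_derivative_circlepath
      [OF holomorphic_on_imp_continuous_on[OF hol] hol', of 0 n] \<rho> by simp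
  have coeff: "cauchy_coeff \<rho> j n F x = (deriv ^^ n) g 0 / fact n" for n
    using contour_integral_unique[OF int[of n]] by (simp add: cauchy_coeff_def g_def)
  show "(\<lambda>n. cauchy_coeff \<rho> j n F x * x $ j ^ n) sums F x" if "cmod (x $ j) < \<rho>"
    using holomorphic_power_series[OF hol', of "x $ j"] that coeff by (simp add: g_def)
  assume M: "\<And>y. y \<in> closed_polycyl \<rho> \<Longrightarrow> cmod (F y) \<le> M" and xK: "x \<in> closed_polycyl \<rho>"
  have M0: "0 \<le> M" using M[OF xK] norm_ge_zero order_trans by blast
  have "cmod (2 * pi * \<i> / fact n * (deriv ^^ n) g 0) \<le> M / \<rho> ^ Suc n * (2 * pi * \<rho>)"
  proof (rule has_contour_integral_bound_circlepath[OF int])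
    fix u assume u: "cmod (u - 0) = \<rho>"
    have "cmod (g u) \<le> M"
      unfolding g_def using u xK by (intro M) (auto simp: closed_polycyl_def)
    then show "cmod (g u / u ^ Suc n) \<le> M / \<rho> ^ Suc n"
      using u \<rho> by (auto simp: norm_divide norm_mult norm_power divide_right_mono)
  qed (use \<rho> M0 in auto)
  then have "2 * pi * cmod (cauchy_coeff \<rho> j n F x) \<le> 2 * pi * (M / \<rho> ^ n)"
    using \<rho> by (simp add: coeff norm_mult norm_divide field_simps)
  then show "cmod (cauchy_coeff \<rho> j n F x) \<le> M / \<rho> ^ n"
    using pi_gt_zero by (subst (asm) mult_le_cancel_left_pos) auto
qed

lemma summable_on_prod_geometric:
  fixes q :: "'m \<Rightarrow> real"
  assumes "finite I" "\<And>i. i \<in> I \<Longrightarrow> 0 \<le> q i" "\<And>i. i \<in> I \<Longrightarrow> q i < 1"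
  shows "(\<lambda>\<alpha>. \<Prod>i\<in>I. q i ^ \<alpha> i) summable_on PiE I (\<lambda>_. UNIV)"
proof -
  have "Infinite_Set_Sum.abs_summable_on (\<lambda>\<alpha>. \<Prod>i\<in>I. q i ^ \<alpha> i) (PiE I (\<lambda>_. UNIV))"
  proof (rule abs_summable_on_prod_PiE)
    fix i assume "i \<in> I"
    then have "summable (\<lambda>n. norm (q i ^ n))"
      using assms by (simp add: norm_power)
    then show "Infinite_Set_Sum.abs_summable_on (\<lambda>n. q i ^ n) UNIV"
      by (simp add: abs_summable_on_nat_iff')
  qed (use assms in auto)
  then show ?thesis
    by (rule abs_summable_summable[OF abs_summable_equivalent[THEN iffD2]])
qed

text \<open>Osgood's lemma by expanding one variable at a time. For a set \<open>I\<close> of variables already expanded, the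
  coefficients are still functions of the others: they stay holomorphic there, no longer depend on the
  variables in \<open>I\<close>, and satisfy the Cauchy estimates, which make the combined series absolutely
  summable. Exponents are extensional functions on \<open>I\<close>, so that adding a variable turns the index set
  into a product.\<close>

lemma curve_holo_partial_power_series:
  fixes F :: "complex^'m::finite \<Rightarrow> complex"
  assumes \<rho>: "0 < \<rho>" "\<rho> < R" and F: "curve_holo F (polycyl 0 R)"
    and M: "\<And>x. x \<in> closed_polycyl \<rho> \<Longrightarrow> cmod (F x) \<le> M" and I: "finite I"
  shows "\<exists>c. (\<forall>\<alpha>\<in>PiE I (\<lambda>_. UNIV). curve_holo (c \<alpha>) (polycyl 0 R) \<and>
        (\<forall>x\<in>closed_polycyl \<rho>. cmod (c \<alpha> x) \<le> M / (\<Prod>i\<in>I. \<rho> ^ \<alpha> i)) \<and>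
        (\<forall>x y. (\<forall>i. i \<notin> I \<longrightarrow> x $ i = y $ i) \<longrightarrow> c \<alpha> x = c \<alpha> y)) \<and>
      (\<forall>x\<in>polycyl 0 \<rho>. ((\<lambda>\<alpha>. c \<alpha> x * (\<Prod>i\<in>I. x $ i ^ \<alpha> i)) has_sum F x) (PiE I (\<lambda>_. UNIV)))"
  using I
proof induction
  case empty
  have "((\<lambda>\<alpha>. F x * (\<Prod>i\<in>{}. x $ i ^ \<alpha> i)) has_sum F x) (PiE {} (\<lambda>_. UNIV :: nat set))" for x
    using has_sum_finite[of "{\<lambda>_. undefined :: nat}" "\<lambda>\<alpha>. F x"] by simp
  moreover have "F x = F y" if "\<forall>i. x $ i = y $ i" for x y
    using that by (metis vec_eq_iff)
  ultimately show ?case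
    using F M by (intro exI[of _ "\<lambda>_. F"]) simp
next
  case (insert j I)
  let ?PI = "PiE I (\<lambda>_. UNIV :: nat set)" and ?PJ = "PiE (insert j I) (\<lambda>_. UNIV :: nat set)"
  obtain c where c1: "\<forall>\<alpha>\<in>?PI. curve_holo (c \<alpha>) (polycyl 0 R) \<and>
        (\<forall>x\<in>closed_polycyl \<rho>. cmod (c \<alpha> x) \<le> M / (\<Prod>i\<in>I. \<rho> ^ \<alpha> i)) \<and>
        (\<forall>x y. (\<forall>i. i \<notin> I \<longrightarrow> x $ i = y $ i) \<longrightarrow> c \<alpha> x = c \<alpha> y)"
    and c2: "\<forall>x\<in>polycyl 0 \<rho>. ((\<lambda>\<alpha>. c \<alpha> x * (\<Prod>i\<in>I. x $ i ^ \<alpha> i)) has_sum F x) ?PI"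
    using insert.IH by (elim exE conjE) (rule that)
  have hol: "\<And>\<alpha>. \<alpha> \<in> ?PI \<Longrightarrow> curve_holo (c \<alpha>) (polycyl 0 R)"
    and bd: "\<And>\<alpha> x. \<lbrakk>\<alpha> \<in> ?PI; x \<in> closed_polycyl \<rho>\<rbrakk> \<Longrightarrow> cmod (c \<alpha> x) \<le> M / (\<Prod>i\<in>I. \<rho> ^ \<alpha> i)"
    and indep: "\<And>\<alpha> x y. \<lbrakk>\<alpha> \<in> ?PI; \<And>i. i \<notin> I \<Longrightarrow> x $ i = y $ i\<rbrakk> \<Longrightarrow> c \<alpha> x = c \<alpha> y"
    and sum: "\<And>x. x \<in> polycyl 0 \<rho> \<Longrightarrow> ((\<lambda>\<alpha>. c \<alpha> x * (\<Prod>i\<in>I. x $ i ^ \<alpha> i)) has_sum F x) ?PI"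
    using c1 c2 by blast+
  define d where "d = (\<lambda>\<beta>. cauchy_coeff \<rho> j (\<beta> j) (c (\<beta>(j := undefined))))"
  have restr: "\<beta>(j := undefined) \<in> ?PI" if "\<beta> \<in> ?PJ" for \<beta>
    using that insert.hyps by (auto simp: PiE_def extensional_def)
  have sub: "x \<in> polycyl 0 R" if "x \<in> closed_polycyl \<rho>" for x :: "complex^'m"
    using that \<rho> by (auto simp: polycyl_def closed_polycyl_def intro: le_less_trans)
  have prodI: "(\<Prod>i\<in>I. a i ^ (\<alpha>(j := n)) i) = (\<Prod>i\<in>I. a i ^ \<alpha> i)" for a :: "'m \<Rightarrow> 'b::comm_monoid_mult" and \<alpha> n
    using insert.hyps by (intro prod.cong) auto
  have dbd: "cmod (d \<beta> x) \<le> M / (\<Prod>i\<in>insert j I. \<rho> ^ \<beta> i)" if "\<beta> \<in> ?PJ" "x \<in> closed_polycyl \<rho>" for \<beta> x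
  proof -
    have "cmod (d \<beta> x) \<le> M / (\<Prod>i\<in>I. \<rho> ^ (\<beta>(j := undefined)) i) / \<rho> ^ \<beta> j"
      unfolding d_def using that sub
      by (intro norm_cauchy_coeff_le[OF hol[OF restr] \<rho>] bd restr) auto
    then show ?thesis
      using insert.hyps by (simp add: prodI mult.commute del: fun_upd_apply)
  qed
  have dindep: "d \<beta> x = d \<beta> y" if "\<beta> \<in> ?PJ" "\<forall>i. i \<notin> insert j I \<longrightarrow> x $ i = y $ i" for \<beta> x y
  proof -
    have "c (\<beta>(j := undefined)) (set_coord j \<zeta> x) = c (\<beta>(j := undefined)) (set_coord j \<zeta> y)" for \<zeta>
      using that by (intro indep restr) auto
    then show ?thesis by (simp add: d_def cauchy_coeff_def)
  qed
  have dsum: "((\<lambda>\<beta>. d \<beta> x * (\<Prod>i\<in>insert j I. x $ i ^ \<beta> i)) has_sum F x) ?PJ" (is "(?f has_sum _) _")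
    if x: "x \<in> polycyl 0 \<rho>" for x
  proof -
    have xK: "x \<in> closed_polycyl \<rho>" and xj: "cmod (x $ j) < \<rho>"
      using x by (auto simp: polycyl_def closed_polycyl_def less_imp_le)
    have abs: "(\<lambda>\<beta>. norm (?f \<beta>)) summable_on ?PJ"
    proof (rule Infinite_Sum.abs_summable_on_comparison_test')
      show "(\<lambda>\<beta>. M * (\<Prod>i\<in>insert j I. (cmod (x $ i) / \<rho>) ^ \<beta> i)) summable_on ?PJ"
        using insert.hyps x \<rho>
        by (intro summable_on_cmult_right summable_on_prod_geometric) (auto simp: polycyl_def)
      show "norm (?f \<beta>) \<le> M * (\<Prod>i\<in>insert j I. (cmod (x $ i) / \<rho>) ^ \<beta> i)" if "\<beta> \<in> ?PJ" for \<beta>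
      proof -
        have "norm (?f \<beta>) \<le> M / (\<Prod>i\<in>insert j I. \<rho> ^ \<beta> i) * (\<Prod>i\<in>insert j I. cmod (x $ i) ^ \<beta> i)"
          unfolding norm_mult prod_norm[symmetric] norm_power
          using dbd[OF that xK] by (intro mult_right_mono prod_nonneg) auto
        also have "\<dots> = M * (\<Prod>i\<in>insert j I. (cmod (x $ i) / \<rho>) ^ \<beta> i)"
          by (simp add: power_divide prod_dividef)
        finally show ?thesis .
      qed
    qed
    have inj: "inj_on (\<lambda>(\<alpha>, n). \<alpha>(j := n)) (?PI \<times> UNIV)"
      using insert.hyps by (intro inj_combinator')
    have img: "?PJ = (\<lambda>(\<alpha>, n). \<alpha>(j := n)) ` (?PI \<times> UNIV)"
      unfolding PiE_insert_eq by (subst swap_product[symmetric]) (simp add: image_image case_prod_unfold)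
    have row: "((\<lambda>n. ?f (\<alpha>(j := n))) has_sum (c \<alpha> x * (\<Prod>i\<in>I. x $ i ^ \<alpha> i))) UNIV" if \<alpha>: "\<alpha> \<in> ?PI" for \<alpha>
    proof (rule norm_summable_imp_has_sum)
      have f: "?f (\<alpha>(j := n)) = cauchy_coeff \<rho> j n (c \<alpha>) x * x $ j ^ n * (\<Prod>i\<in>I. x $ i ^ \<alpha> i)" for n
      proof -
        have "\<alpha>(j := undefined) = \<alpha>" using \<alpha> insert.hyps by (auto simp: PiE_def extensional_def)
        then show ?thesis using insert.hyps by (simp add: d_def prodI fun_upd_same del: fun_upd_apply)
      qed
      show "(\<lambda>n. ?f (\<alpha>(j := n))) sums (c \<alpha> x * (\<Prod>i\<in>I. x $ i ^ \<alpha> i))"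
        unfolding f using xj by (intro sums_mult2 cauchy_coeff_sums[OF hol[OF \<alpha>] \<rho> sub[OF xK]])
      have "(\<lambda>n. norm (?f (\<alpha>(j := n)))) summable_on UNIV"
      proof -
        have "(\<lambda>\<beta>. norm (?f \<beta>)) summable_on ((\<lambda>n. \<alpha>(j := n)) ` UNIV)"
          using \<alpha> by (intro summable_on_subset_banach[OF abs]) (auto simp: img)
        then show ?thesis
          by (subst (asm) summable_on_reindex) (auto simp: inj_on_def o_def dest: fun_cong[where x = j])
      qed
      then show "summable (\<lambda>n. norm (?f (\<alpha>(j := n))))"
        by (simp add: summable_on_UNIV_nonneg_real_iff)
    qed
    have "((\<lambda>(\<alpha>, n). ?f (\<alpha>(j := n))) has_sum F x) (?PI \<times> UNIV)"
    proof (rule has_sum_SigmaI[OF _ sum[OF x]])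
      show "((\<lambda>n. (\<lambda>(\<alpha>, n). ?f (\<alpha>(j := n))) (\<alpha>, n)) has_sum (c \<alpha> x * (\<Prod>i\<in>I. x $ i ^ \<alpha> i))) UNIV"
        if "\<alpha> \<in> ?PI" for \<alpha>
        using row[OF that] by simp
      show "(\<lambda>(\<alpha>, n). ?f (\<alpha>(j := n))) summable_on ?PI \<times> UNIV"
        using abs_summable_summable[OF abs] unfolding img
        by (subst (asm) summable_on_reindex[OF inj]) (simp add: o_def case_prod_unfold)
    qed
    then show ?thesis
      unfolding img by (subst has_sum_reindex[OF inj]) (simp add: o_def case_prod_unfold)
  qed
  show ?case
    using dbd dindep dsum restr
    by (intro exI[of _ d] conjI ballI) (auto simp: d_def intro!: curve_holo_cauchy_coeff[OF hol \<rho>])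
qed

text \<open>Once all variables are expanded the coefficients depend on no variable, that is, they are constants.\<close>

theorem curve_holo_imp_holo_at:
  fixes F :: "complex^'m::finite \<Rightarrow> complex"
  assumes F: "curve_holo F (polycyl p R)" and R: "0 < R"
  shows "holo_at F p"
proof -
  define G where "G = (\<lambda>y. F (p + y))"
  define \<rho> where "\<rho> = R / 2"
  have \<rho>: "0 < \<rho>" "\<rho> < R" using R by (auto simp: \<rho>_def)
  have G: "curve_holo G (polycyl 0 R)"
    unfolding G_def by (rule curve_holo_compose[OF F]) (auto intro!: curve_holo_add)
  have "closed_polycyl \<rho> = (\<Inter>i\<in>UNIV. {x :: complex^'m. cmod (x $ i) \<le> \<rho>})"
    by (auto simp: closed_polycyl_def)
  moreover have "closed {x :: complex^'m. cmod (x $ i) \<le> \<rho>}" for i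
    by (intro closed_Collect_le continuous_intros)
  ultimately have "closed (closed_polycyl \<rho> :: (complex^'m) set)"
    by (metis closed_INT)
  moreover have "norm x \<le> (\<Sum>i\<in>(UNIV :: 'm set). \<rho>)" if "x \<in> closed_polycyl \<rho>" for x :: "complex^'m"
  proof -
    have "norm x \<le> (\<Sum>i\<in>UNIV. cmod (x $ i))"
      unfolding norm_vec_def by (intro L2_set_le_sum) auto
    also have "\<dots> \<le> (\<Sum>i\<in>(UNIV :: 'm set). \<rho>)"
      using that by (intro sum_mono) (auto simp: closed_polycyl_def)
    finally show ?thesis .
  qed
  ultimately have "compact (closed_polycyl \<rho> :: (complex^'m) set)"
    by (auto simp: compact_eq_bounded_closed bounded_iff)
  moreover have "closed_polycyl \<rho> \<subseteq> (polycyl 0 R :: (complex^'m) set)"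
    using \<rho> by (auto simp: polycyl_def closed_polycyl_def intro: le_less_trans)
  ultimately have "compact (G ` closed_polycyl \<rho>)"
    using curve_holo_continuous[OF G] continuous_on_subset compact_continuous_image by blast
  then obtain M where M: "\<And>x. x \<in> closed_polycyl \<rho> \<Longrightarrow> cmod (G x) \<le> M"
    using compact_imp_bounded bounded_iff by (metis imageI)
  obtain c where c1: "\<forall>\<alpha>\<in>PiE UNIV (\<lambda>_. UNIV :: nat set). curve_holo (c \<alpha>) (polycyl 0 R) \<and>
        (\<forall>x\<in>closed_polycyl \<rho>. cmod (c \<alpha> x) \<le> M / (\<Prod>i\<in>UNIV. \<rho> ^ \<alpha> i)) \<and>
        (\<forall>x y. (\<forall>i. i \<notin> UNIV \<longrightarrow> x $ i = y $ i) \<longrightarrow> c \<alpha> x = c \<alpha> y)"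
    and c2: "\<forall>x\<in>polycyl 0 \<rho>. ((\<lambda>\<alpha>. c \<alpha> x * (\<Prod>i\<in>UNIV. x $ i ^ \<alpha> i)) has_sum G x)
        (PiE UNIV (\<lambda>_. UNIV :: nat set))"
    by (rule exE[OF curve_holo_partial_power_series[OF \<rho> G _ finite[of UNIV]]], erule M, elim conjE, rule that)
  have indep: "c \<alpha> x = c \<alpha> y" for \<alpha> x y
    using c1 by (auto simp: PiE_UNIV_domain)
  have sum: "((\<lambda>\<alpha>. c \<alpha> x * (\<Prod>i\<in>UNIV. x $ i ^ \<alpha> i)) has_sum G x) UNIV" if "x \<in> polycyl 0 \<rho>" for x
    using c2 that by simp
  show ?thesis
    unfolding holo_at_def
  proof (intro exI conjI allI impI)
    fix x assume "\<forall>i. cmod (x $ i - p $ i) < \<rho>"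
    then have "x - p \<in> polycyl 0 \<rho>" by (simp add: polycyl_def)
    from sum[OF this] show "((\<lambda>\<alpha>. c \<alpha> 0 * monomial \<alpha> (x - p)) has_sum F x) UNIV"
      by (simp add: monomial_def G_def indep[of _ "x - p" 0])
  qed (use \<rho> in auto)
qed

section \<open>Germs and complexification\<close>

lemma curve_holo_polycyl_mono: "\<lbrakk>curve_holo F (polycyl p r); s \<le> r\<rbrakk> \<Longrightarrow> curve_holo F (polycyl p s)"
  using curve_holo_subset polycyl_mono by blast

lemma holo_at_iff_curve_holo: "holo_at F p \<longleftrightarrow> (\<exists>r>0. curve_holo F (polycyl p r))"
  using curve_holo_imp_holo_at holo_at_imp_curve_holo by metis

lemma holo_at_diff:
  assumes "holo_at F p" "holo_at G p"
  shows "holo_at (\<lambda>x. F x - G x) p"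
proof -
  obtain r s where "0 < r" "0 < s" "curve_holo F (polycyl p r)" "curve_holo G (polycyl p s)"
    using assms by (auto simp: holo_at_iff_curve_holo)
  then have "curve_holo (\<lambda>x. F x - G x) (polycyl p (min r s))"
    by (intro curve_holo_diff) (auto elim: curve_holo_polycyl_mono)
  with \<open>0 < r\<close> \<open>0 < s\<close> show ?thesis
    by (auto simp: holo_at_iff_curve_holo intro!: exI[of _ "min r s"])
qed

lemma holo_at_power: "holo_at F p \<Longrightarrow> holo_at (\<lambda>x. F x ^ n) p"
  by (auto simp: holo_at_iff_curve_holo intro: curve_holo_power)

lemma pt_Inl [simp]: "pt z \<xi> $ Inl j = z $ j" and pt_Inr [simp]: "pt z \<xi> $ Inr j = \<xi> $ j"
  by (simp_all add: pt_def)

lemma pt_in_polycyl_iff [simp]: "pt z \<xi> \<in> polycyl 0 r \<longleftrightarrow> z \<in> polycyl 0 r \<and> \<xi> \<in> polycyl 0 r"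
proof
  assume "pt z \<xi> \<in> polycyl 0 r"
  then have *: "cmod (pt z \<xi> $ i) < r" for i
    by (simp add: polycyl_def)
  have "cmod (z $ j) < r" "cmod (\<xi> $ j) < r" for j
    using *[of "Inl j"] *[of "Inr j"] by simp_all
  then show "z \<in> polycyl 0 r \<and> \<xi> \<in> polycyl 0 r" by (simp add: polycyl_def)
next
  assume "z \<in> polycyl 0 r \<and> \<xi> \<in> polycyl 0 r"
  then show "pt z \<xi> \<in> polycyl 0 r"
    by (auto simp: polycyl_def pt_def split: sum.split)
qed

lemma vcnj_nth [simp]: "vcnj z $ j = cnj (z $ j)"
  by (simp add: vcnj_def)

lemma vcnj_in_polycyl_iff [simp]: "vcnj z \<in> polycyl 0 r \<longleftrightarrow> z \<in> polycyl 0 r"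
  by (simp add: polycyl_def)

lemma proj1_pt [simp]: "proj1 (pt z \<xi>) = z"
  by (simp add: proj1_def vec_eq_iff)

lemma pt_surj: obtains z \<xi> where "w = pt z \<xi>"
proof
  show "w = pt (proj1 w) (\<chi> j. w $ Inr j)"
    unfolding vec_eq_iff by (auto simp: pt_def proj1_def split: sum.split)
qed

lemma holo_at_proj1:
  fixes g :: "complex^'n::finite \<Rightarrow> complex"
  assumes "holo_at g 0"
  shows "holo_at (\<lambda>w. g (proj1 w)) 0"
proof -
  obtain r where r: "0 < r" "curve_holo g (polycyl 0 r)"
    using assms by (auto simp: holo_at_iff_curve_holo)
  have "curve_holo (\<lambda>w. g (proj1 w)) (polycyl 0 r)"
    by (rule curve_holo_compose[OF r(2)]) (auto simp: proj1_def polycyl_def)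
  with r show ?thesis by (auto simp: holo_at_iff_curve_holo)
qed

text \<open>The points \<open>(z, cnj z)\<close> form a maximally totally real subspace. Every \<open>w = (z, \<xi>)\<close> is \<open>P + \<i> Q\<close> with \<open>P\<close> and
  \<open>Q\<close> in this subspace, so the identity theorem on the complex line \<open>s \<mapsto> P + s Q\<close> suffices. The radius
  shrinks by a factor \<open>3\<close> in order that the disc \<open>\<bar>s\<bar> < 2\<close> remains in the domain.\<close>

lemma curve_holo_zero_if_zero_on_conjugates:
  fixes G :: "complex^('n::finite + 'n) \<Rightarrow> complex"
  assumes G: "curve_holo G (polycyl 0 r)"
    and zero: "\<And>z. z \<in> polycyl 0 r \<Longrightarrow> G (pt z (vcnj z)) = 0"
    and w: "w \<in> polycyl 0 (r / 3)"
  shows "G w = 0"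
proof -
  obtain z \<xi> where w_eq: "w = pt z \<xi>" using pt_surj .
  have z: "cmod (z $ j) < r / 3" "cmod (\<xi> $ j) < r / 3" for j
    using w unfolding w_eq pt_in_polycyl_iff by (auto simp: polycyl_def)
  define a b where "a = (\<chi> j. (z $ j + cnj (\<xi> $ j)) / 2)" and "b = (\<chi> j. (z $ j - cnj (\<xi> $ j)) / (2 * \<i>))"
  define \<gamma> where "\<gamma> = (\<lambda>s. pt (\<chi> j. a $ j + s * b $ j) (\<chi> j. cnj (a $ j) + s * cnj (b $ j)))"
  have ab: "cmod (a $ j) < r / 3" "cmod (b $ j) < r / 3" for j
  proof -
    have "cmod (z $ j + cnj (\<xi> $ j)) < 2 * (r / 3)" "cmod (z $ j - cnj (\<xi> $ j)) < 2 * (r / 3)"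
      using norm_triangle_ineq[of "z $ j" "cnj (\<xi> $ j)"] norm_triangle_ineq4[of "z $ j" "cnj (\<xi> $ j)"] z[of j]
      by auto
    then show "cmod (a $ j) < r / 3" "cmod (b $ j) < r / 3"
      by (auto simp: a_def b_def norm_divide norm_mult)
  qed
  have bound: "cmod (x + s * y) < r" if "cmod x < r / 3" "cmod y < r / 3" "cmod s < 2" for x y s
  proof -
    have "cmod (s * y) \<le> 2 * (r / 3)"
      unfolding norm_mult using that by (intro mult_mono) auto
    then show ?thesis using norm_triangle_ineq[of x "s * y"] that by linarith
  qed
  have hol: "(\<lambda>s. G (\<gamma> s)) holomorphic_on ball 0 2"
  proof (rule curve_holo_along[OF G])
    fix i show "(\<lambda>s. \<gamma> s $ i) holomorphic_on ball 0 2"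
      by (cases i) (auto simp: \<gamma>_def intro!: holomorphic_intros)
  next
    fix s :: complex assume "s \<in> ball 0 2"
    then show "\<gamma> s \<in> polycyl 0 r"
      using ab unfolding \<gamma>_def pt_in_polycyl_iff by (auto simp: polycyl_def intro!: bound)
  qed auto
  \<comment> \<open>For real parameters the curve runs through the conjugate points, and it reaches \<open>w\<close> at \<open>\<i>\<close>.\<close>
  have real_zero: "G (\<gamma> (of_real t)) = 0" if "\<bar>t\<bar> < 2" for t
  proof -
    have "\<gamma> (of_real t) = pt (\<chi> j. a $ j + t * b $ j) (vcnj (\<chi> j. a $ j + t * b $ j))"
      by (simp add: \<gamma>_def vcnj_def)
    moreover have "(\<chi> j. a $ j + t * b $ j) \<in> polycyl 0 r"
      using ab that by (auto simp: polycyl_def intro!: bound)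
    ultimately show ?thesis using zero by simp
  qed
  have "\<gamma> \<i> = w"
    by (simp add: \<gamma>_def w_eq a_def b_def field_simps)
  moreover have "G (\<gamma> \<i>) = 0"
  proof (rule analytic_continuation[OF hol])
    show "of_real ` {-1<..<1} \<subseteq> ball (0::complex) 2" by auto
    show "0 islimpt complex_of_real ` {-1<..<1}"
      unfolding islimpt_approachable
    proof (intro allI impI)
      fix e :: real assume "e > 0"
      then show "\<exists>x'\<in>complex_of_real ` {-1<..<1}. x' \<noteq> 0 \<and> dist x' 0 < e"
        by (intro bexI[of _ "of_real (min (e / 2) (1 / 2))"]) (auto simp: min_def)
    qed
  qed (use real_zero in auto)
  ultimately show ?thesis by simp
qed

text \<open>This makes \<^const>\<open>complexify\<close> multiplicative on germs: the complexification of \<open>f ^ l\<close> is the \<open>l\<close>-th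
  power of the one of \<open>f\<close>.\<close>

lemma germ_eq_complexification_unique:
  fixes F G :: "complex^('n::finite + 'n) \<Rightarrow> complex"
  assumes F: "holo_at F 0" and G: "holo_at G 0"
    and eq: "germ_eq (\<lambda>z. F (pt z (vcnj z))) (\<lambda>z. G (pt z (vcnj z)))"
  shows "germ_eq F G"
proof -
  obtain r where r: "0 < r" "curve_holo (\<lambda>x. F x - G x) (polycyl 0 r)"
    using holo_at_diff[OF F G] by (auto simp: holo_at_iff_curve_holo)
  obtain s where s: "0 < s" "\<And>z. z \<in> polycyl 0 s \<Longrightarrow> F (pt z (vcnj z)) = G (pt z (vcnj z))"
    using eq by (auto simp: eventually_nhds_polycyl)
  have "F w - G w = 0" if "w \<in> polycyl 0 (min r s / 3)" for w
  proof (rule curve_holo_zero_if_zero_on_conjugates[OF _ _ that])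
    show "curve_holo (\<lambda>x. F x - G x) (polycyl 0 (min r s))"
      using r by (auto elim: curve_holo_polycyl_mono)
    show "F (pt z (vcnj z)) - G (pt z (vcnj z)) = 0" if "z \<in> polycyl 0 (min r s)" for z
      using s(2) that polycyl_mono[of "min r s" s 0] by auto
  qed
  with r s show ?thesis
    by (auto simp: eventually_nhds_polycyl intro!: exI[of _ "min r s / 3"])
qed

lemma complexify_props:
  assumes "real_analytic_at f 0"
  shows holo_at_complexify: "holo_at (complexify f) 0"
    and germ_eq_complexify: "germ_eq f (\<lambda>z. complexify f (pt z (vcnj z)))"
proof -
  have "pt 0 (vcnj 0) = (0 :: complex^('a + 'a))"
    by (auto simp: vec_eq_iff pt_def split: sum.split)
  then have "\<exists>F. holo_at F 0 \<and> germ_eq f (\<lambda>z. F (pt z (vcnj z)))"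
    using assms by (auto simp: real_analytic_at_def)
  from someI_ex[OF this]
  show "holo_at (complexify f) 0" "germ_eq f (\<lambda>z. complexify f (pt z (vcnj z)))"
    by (simp_all add: complexify_def)
qed

section \<open>Extension over a thin set\<close>

text \<open>The case of Riemann's extension theorem for functions known to be continuous. On a complex line through
  \<open>p\<close> on which \<open>h\<close> is not identically zero, choose a small circle \<open>\<bar>t\<bar> = \<delta>\<close> free of zeros. Parallel lines
  through nearby points \<open>x\<close> also avoid the zero set on this circle and meet it in finitely many points
  inside; these are removable because \<open>a\<close> is continuous. Hence \<open>a x\<close> is the Cauchy integral of \<open>a\<close> over the circle,
  where \<open>a\<close> is already known to be holomorphic.\<close>

lemma curve_holo_extends_over_zero_set:
  fixes a h :: "complex^'m::finite \<Rightarrow> complex"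
  assumes a: "continuous_on (polycyl p r) a" and h: "curve_holo h (polycyl p r)"
    and v: "v \<in> polycyl p r" "h v \<noteq> 0"
    and off: "\<And>x. \<lbrakk>x \<in> polycyl p r; h x \<noteq> 0\<rbrakk> \<Longrightarrow> \<exists>V. open V \<and> x \<in> V \<and> curve_holo a V"
  shows "\<exists>r'>0. curve_holo a (polycyl p r')"
proof -
  define d where "d = v - p"
  define L where "L = (\<lambda>x t. x + t *s d)"
  define S where "S = (\<lambda>x. {t. L x t \<in> polycyl p r})"
  have Lnth: "L x t $ i = x $ i + t * d $ i" for x t i by (simp add: L_def)
  have d: "cmod (d $ i) < r" for i using v(1) by (simp add: polycyl_def d_def)
  have a_off: "curve_holo a {x \<in> polycyl p r. h x \<noteq> 0}"
    by (rule curve_holo_local) (use off in auto)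
  have contL: "continuous_on A (\<lambda>w. L (fst w) (snd w))" for A
  proof -
    have "continuous_on A (\<lambda>w. \<chi> i. L (fst w) (snd w) $ i)"
      unfolding Lnth by (intro continuous_on_vec_lambda continuous_intros)
    then show ?thesis by simp
  qed
  have contLx: "continuous_on A (L x)" for A x
    using continuous_on_compose2[OF contL[of UNIV], of A "Pair x"] by (simp add: continuous_on_Pair)
  have openS: "open (S x)" for x
    using open_vimage[OF open_polycyl contLx[of UNIV x]] by (simp add: S_def vimage_def)
  have convS: "convex (S x)" for x
  proof (rule convexI)
    fix s t :: complex and u w :: real
    assume st: "s \<in> S x" "t \<in> S x" and uw: "0 \<le> u" "0 \<le> w" "u + w = 1"
    have "cmod (x $ i + (u *\<^sub>R s + w *\<^sub>R t) * d $ i - p $ i) < r" for i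
    proof -
      have w: "w = 1 - u" using uw by simp
      have "x $ i + (u *\<^sub>R s + w *\<^sub>R t) * d $ i - p $ i =
          u *\<^sub>R (x $ i + s * d $ i - p $ i) + w *\<^sub>R (x $ i + t * d $ i - p $ i)"
        unfolding w by (simp add: scaleR_conv_of_real algebra_simps)
      moreover have "x $ i + s * d $ i - p $ i \<in> ball 0 r" "x $ i + t * d $ i - p $ i \<in> ball 0 r"
        using st by (auto simp: S_def polycyl_def Lnth)
      ultimately show ?thesis
        by (metis convexD[OF convex_ball _ _ uw] mem_ball_0)
    qed
    then show "u *\<^sub>R s + w *\<^sub>R t \<in> S x" by (simp add: S_def polycyl_def Lnth)
  qed
  have hol: "(\<lambda>t. h (L x t)) holomorphic_on S x" for x
    by (rule curve_holo_along[OF h openS]) (auto simp: S_def Lnth intro!: holomorphic_intros)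
  have in_Sp: "t \<in> S p" if "cmod t \<le> 1" for t
  proof -
    have "cmod (t * d $ i) < r" for i
      using mult_right_mono[OF that, of "cmod (d $ i)"] d[of i] by (simp add: norm_mult)
    then show ?thesis by (simp add: S_def polycyl_def Lnth)
  qed
  have h1: "h (L p 1) \<noteq> 0" using v by (simp add: L_def d_def)
  obtain e where e: "e > 0" "\<And>t. t \<in> ball 0 e - {0} \<Longrightarrow> h (L p t) \<noteq> 0"
  proof (cases "h (L p 0) = 0")
    case True
    have "0 \<in> S p" "1 \<in> S p" using in_Sp by auto
    then show ?thesis
      by (rule isolated_zeros[OF hol openS convex_connected[OF convS] _ True _ h1]) (use that in blast)+
  next
    case False
    have "open (S p \<inter> (\<lambda>t. h (L p t)) -` (- {0}))"
      using continuous_open_preimage[OF holomorphic_on_imp_continuous_on[OF hol] openS] by (simp add: open_Compl)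
    moreover have "0 \<in> S p \<inter> (\<lambda>t. h (L p t)) -` (- {0})" using False in_Sp by simp
    ultimately obtain e where "e > 0" "ball 0 e \<subseteq> S p \<inter> (\<lambda>t. h (L p t)) -` (- {0})"
      using open_contains_ball by blast
    then show ?thesis using that[of e] by blast
  qed
  \<comment> \<open>Since \<open>\<delta> < 1\<close>, the disc \<open>\<bar>t\<bar> \<le> \<delta>\<close> on the line through \<open>p\<close> lies in the domain.\<close>
  define \<delta> where "\<delta> = min (e / 2) (1 / 2)"
  have \<delta>: "0 < \<delta>" "\<delta> < e" "\<delta> < 1" using e(1) by (auto simp: \<delta>_def)
  define W where "W = {w. L (fst w) (snd w) \<in> polycyl p r}"
  define W' where "W' = W \<inter> (\<lambda>w. h (L (fst w) (snd w))) -` (- {0})"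
  have openW: "open W"
    using open_vimage[OF open_polycyl contL[of UNIV]] by (simp add: W_def vimage_def)
  have "continuous_on W (\<lambda>w. h (L (fst w) (snd w)))"
    by (rule continuous_on_compose2[OF curve_holo_continuous[OF h] contL]) (auto simp: W_def)
  then have openW': "open W'"
    unfolding W'_def by (rule continuous_open_preimage[OF _ openW]) (simp add: open_Compl)
  have "\<exists>X. p \<in> X \<and> open X \<and> X \<times> cball 0 \<delta> \<subseteq> W"
    by (rule Elementary_Topology.tube_lemma[OF _ openW]) (use in_Sp \<delta> in \<open>auto simp: W_def S_def\<close>)
  moreover have "\<exists>X. p \<in> X \<and> open X \<and> X \<times> sphere 0 \<delta> \<subseteq> W'"
    by (rule Elementary_Topology.tube_lemma[OF _ openW']) (use in_Sp \<delta> e(2) in \<open>auto simp: W'_def W_def S_def\<close>)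
  ultimately obtain X X' where X: "p \<in> X" "open X" "X \<times> cball 0 \<delta> \<subseteq> W" "p \<in> X'" "open X'" "X' \<times> sphere 0 \<delta> \<subseteq> W'"
    by blast
  then have "open (X \<inter> X')" "p \<in> X \<inter> X'" by auto
  then obtain r' where r': "0 < r'" "polycyl p r' \<subseteq> X \<inter> X'"
    using open_contains_polycyl by blast
  have sub: "cball 0 \<delta> \<subseteq> S x" if "x \<in> polycyl p r'" for x
  proof
    fix t :: complex assume "t \<in> cball 0 \<delta>"
    then have "(x, t) \<in> W" using X(3) r'(2) that by blast
    then show "t \<in> S x" by (simp add: W_def S_def)
  qed
  have inP: "L x t \<in> polycyl p r" if "x \<in> polycyl p r'" "cmod t \<le> \<delta>" for x t
    using subsetD[OF sub[OF that(1)], of t] that(2) by (simp add: S_def)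
  have nz: "h (L x t) \<noteq> 0" if "x \<in> polycyl p r'" "cmod t = \<delta>" for x t
  proof -
    have "(x, t) \<in> X' \<times> sphere 0 \<delta>" using r'(2) that by auto
    then have "(x, t) \<in> W'" using X(6) by blast
    then show ?thesis by (simp add: W'_def)
  qed
  have cauchy: "a x = 1 / (2 * of_real pi * \<i>) * contour_integral (circlepath 0 \<delta>) (\<lambda>t. a (L x t) / t)"
    if x: "x \<in> polycyl p r'" for x
  proof -
    define Z where "Z = {t \<in> cball 0 \<delta>. h (L x t) = 0}"
    have "finite Z"
    proof (cases "(\<lambda>t. h (L x t)) constant_on S x")
      case True
      then obtain c where c: "\<And>t. t \<in> S x \<Longrightarrow> h (L x t) = c" by (auto simp: constant_on_def)
      have "h (L x \<delta>) \<noteq> 0" "complex_of_real \<delta> \<in> S x" using nz[OF x] sub[OF x] \<delta> by auto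
      with c sub[OF x] have "Z = {}" by (auto simp: Z_def)
      then show ?thesis by simp
    next
      case False
      then show ?thesis unfolding Z_def
        using holomorphic_compact_finite_zeros[OF hol openS convex_connected[OF convS] _ sub[OF x]] by auto
    qed
    have "(\<lambda>t. a (L x t)) holomorphic_on ball 0 \<delta> - Z"
    proof (rule curve_holo_along[OF a_off])
      show "open (ball 0 \<delta> - Z)" using \<open>finite Z\<close> by (simp add: finite_imp_closed open_Diff)
      show "L x t \<in> {x \<in> polycyl p r. h x \<noteq> 0}" if "t \<in> ball 0 \<delta> - Z" for t
        using that inP[OF x] by (auto simp: Z_def)
    qed (auto simp: Lnth intro!: holomorphic_intros)
    then have diff: "(\<lambda>t. a (L x t)) field_differentiable at t" if "t \<in> interior (cball 0 \<delta>) - Z" for t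
      using that \<open>finite Z\<close>
      by (auto simp: holomorphic_on_imp_differentiable_at finite_imp_closed open_Diff)
    have cont: "continuous_on (cball 0 \<delta>) (\<lambda>t. a (L x t))"
      using inP[OF x] by (intro continuous_on_compose2[OF a contLx]) auto
    have "((\<lambda>t. a (L x t) / (t - 0)) has_contour_integral
        2 * pi * \<i> * winding_number (circlepath 0 \<delta>) 0 * a (L x 0)) (circlepath 0 \<delta>)"
      by (rule Cauchy_integral_formula_convex[OF convex_cball \<open>finite Z\<close> cont diff]) (use \<delta> in auto)
    from contour_integral_unique[OF this] show ?thesis
      using \<delta> by (simp add: winding_number_circlepath L_def)
  qed
  have "curve_holo (\<lambda>x. contour_integral (circlepath 0 \<delta>) (\<lambda>t. a (L x t) / t)) (polycyl p r')"
  proof (rule curve_holo_contour_integral[OF \<delta>(1)])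
    show "continuous_on (polycyl p r' \<times> sphere 0 \<delta>) (\<lambda>(x, t). a (L x t) / t)"
      unfolding case_prod_unfold
    proof (intro continuous_on_divide continuous_on_compose2[OF a contL] continuous_on_snd continuous_on_id)
      show "(\<lambda>w. L (fst w) (snd w)) ` (polycyl p r' \<times> sphere 0 \<delta>) \<subseteq> polycyl p r"
        using inP by auto
    qed (use \<delta> in auto)
  next
    fix t :: complex assume t: "t \<in> sphere 0 \<delta>"
    have "curve_holo (\<lambda>x. a (L x t)) (polycyl p r')"
    proof (rule curve_holo_compose[OF a_off])
      show "curve_holo (\<lambda>x. L x t $ i) (polycyl p r')" for i
        unfolding Lnth by (intro curve_holo_add) auto
      show "L x t \<in> {x \<in> polycyl p r. h x \<noteq> 0}" if "x \<in> polycyl p r'" for x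
        using that t nz inP by auto
    qed
    then show "curve_holo (\<lambda>x. a (L x t) / t) (polycyl p r')"
      unfolding divide_inverse by (intro curve_holo_mult) auto
  qed
  then have "curve_holo (\<lambda>x. 1 / (2 * of_real pi * \<i>) *
      contour_integral (circlepath 0 \<delta>) (\<lambda>t. a (L x t) / t)) (polycyl p r')"
    by (intro curve_holo_mult) auto
  then have "curve_holo a (polycyl p r')"
    by (rule curve_holo_cong) (simp add: cauchy)
  with r'(1) show ?thesis by blast
qed

section \<open>Equal power sums\<close>

text \<open>The hypothesis says that the sum of \<open>P (y j)\<close> equals \<open>card J * P a\<close> for all polynomials \<open>P\<close> of degree at most
  \<open>card J\<close>. If \<open>y j \<noteq> a\<close>, the polynomial vanishing at \<open>a\<close> and at all values other than \<open>y j\<close> has such a degree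
  and contradicts this.\<close>

lemma all_equal_if_power_sums_equal:
  fixes y :: "'a \<Rightarrow> complex"
  assumes J: "finite J"
    and sums: "\<And>l. l \<in> {1..card J} \<Longrightarrow> (\<Sum>j\<in>J. y j ^ l) = of_nat (card J) * a ^ l"
    and j: "j \<in> J"
  shows "y j = a"
proof (rule ccontr)
  assume neq: "y j \<noteq> a"
  define V where "V = insert a (y ` J) - {y j}"
  define P where "P = (\<Prod>v\<in>V. [:- v, 1:])"
  have V: "finite V" "a \<in> V" using J neq by (auto simp: V_def)
  have "card V \<le> card J"
  proof -
    have "V = insert a (y ` J - {y j})" using neq by (auto simp: V_def)
    then have "card V \<le> Suc (card (y ` J - {y j}))" by (simp add: card_insert_le_m1 card_insert_if J)
    also have "\<dots> = card (y ` J)" using J j by (metis card_Suc_Diff1 finite_imageI imageI)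
    also have "\<dots> \<le> card J" using J card_image_le by blast
    finally show ?thesis .
  qed
  moreover have "degree P \<le> card V"
    unfolding P_def using degree_prod_sum_le[OF V(1), of "\<lambda>v. [:- v, 1:]"] by (simp add: o_def)
  ultimately have deg: "degree P \<le> card J" by simp
  have "(\<Sum>i\<in>J. poly P (y i)) = (\<Sum>l\<le>degree P. coeff P l * (\<Sum>i\<in>J. y i ^ l))"
    unfolding poly_altdef sum_distrib_left by (rule sum.swap)
  also have "\<dots> = (\<Sum>l\<le>degree P. coeff P l * (of_nat (card J) * a ^ l))"
  proof (intro sum.cong refl arg_cong2[where f = "(*)"])
    fix l assume "l \<in> {..degree P}"
    then show "(\<Sum>i\<in>J. y i ^ l) = of_nat (card J) * a ^ l"
      using sums[of l] deg by (cases "l = 0") auto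
  qed
  also have "\<dots> = of_nat (card J) * poly P a"
    by (simp add: poly_altdef sum_distrib_left mult_ac)
  also have "poly P a = 0"
    using V by (auto simp: P_def poly_prod intro!: prod_zero)
  finally have "(\<Sum>i\<in>J. poly P (y i)) = 0" by simp
  moreover have "(\<Sum>i\<in>J. poly P (y i)) = (\<Sum>i\<in>{i \<in> J. y i = y j}. poly P (y j))"
  proof (rule sum.mono_neutral_cong_right)
    show "\<forall>i\<in>J - {i \<in> J. y i = y j}. poly P (y i) = 0"
      using V by (auto simp: P_def poly_prod V_def intro!: prod_zero)
  qed (use J in auto)
  moreover have "poly P (y j) \<noteq> 0"
    using V(1) by (auto simp: P_def poly_prod V_def)
  moreover have "card {i \<in> J. y i = y j} \<noteq> 0"
    using J j by auto
  ultimately show False by simp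
qed

section \<open>Finite projections\<close>

lemma curve_holo_if_holo_at:
  assumes "\<And>x. x \<in> U \<Longrightarrow> holo_at h x"
  shows "curve_holo h U"
  using assms by (intro curve_holo_local) (metis holo_at_iff_curve_holo center_in_polycyl open_polycyl)

lemma proper_map_fibers_small:
  fixes W :: "'a::metric_space set" and \<pi> :: "'a \<Rightarrow> 'b::metric_space"
  assumes proper: "proper_map (top_of_set W) (top_of_set D) \<pi>" and D: "open D" "y \<in> D"
    and N: "open N" "\<And>w. \<lbrakk>w \<in> W; \<pi> w = y\<rbrakk> \<Longrightarrow> w \<in> N"
  shows "eventually (\<lambda>z. \<forall>w\<in>W. \<pi> w = z \<longrightarrow> w \<in> N) (nhds y)"
proof -
  have "closedin (top_of_set W) (W \<inter> - N)"
    using N by (intro closedin_closed_Int) auto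
  then have "closedin (top_of_set D) (\<pi> ` (W \<inter> - N))"
    using proper_imp_closed_map[OF proper] by (simp add: closed_map_def)
  then have "openin (top_of_set D) (D - \<pi> ` (W \<inter> - N))"
    by (metis openin_diff openin_topspace topspace_euclidean_subtopology)
  then have "open (D - \<pi> ` (W \<inter> - N))"
    using D by (simp add: openin_open_eq)
  then show ?thesis
    unfolding eventually_nhds using D N
    by (intro exI[of _ "D - \<pi> ` (W \<inter> - N)"]) blast
qed

text \<open>A proper surjection is a quotient map over compact sets.\<close>

lemma continuous_on_proper_descent:
  fixes W :: "'a::metric_space set" and \<pi> :: "'a \<Rightarrow> 'b::metric_space" and F :: "'a \<Rightarrow> 'c::metric_space"
  assumes proper: "proper_map (top_of_set W) (top_of_set D) \<pi>" and C: "compact C" "C \<subseteq> D" "C \<subseteq> \<pi> ` W"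
    and cont: "continuous_on W \<pi>" "continuous_on {w \<in> W. \<pi> w \<in> C} F"
    and F: "\<And>w. \<lbrakk>w \<in> W; \<pi> w \<in> C\<rbrakk> \<Longrightarrow> F w = a (\<pi> w)"
  shows "continuous_on C a"
proof -
  define K where "K = {w \<in> W. \<pi> w \<in> C}"
  have "compactin (top_of_set W) {w \<in> topspace (top_of_set W). \<pi> w \<in> C}"
    using C by (intro compactin_proper_map_preimage[OF proper]) (simp add: compactin_subtopology)
  then have K: "compact K"
    by (simp add: compactin_subtopology K_def)
  have "closedin (top_of_set C) (C \<inter> a -` T)" if "closed T" for T
  proof -
    have "closed (K \<inter> F -` T)"
      using cont(2) unfolding K_def[symmetric]
      by (rule continuous_closed_preimage[OF _ compact_imp_closed[OF K] that])
    then have "compact (K \<inter> F -` T)"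
      using K by (metis compact_Int_closed inf.left_idem)
    then have "compact (\<pi> ` (K \<inter> F -` T))"
      by (rule compact_continuous_image[rotated]) (auto intro: continuous_on_subset[OF cont(1)] simp: K_def)
    moreover have "C \<inter> a -` T = \<pi> ` (K \<inter> F -` T)"
      using F C(3) by (force simp: K_def)
    ultimately show ?thesis
      by (metis closed_subset compact_imp_closed inf_le1)
  qed
  then show ?thesis by (simp add: continuous_closedin_preimage_eq)
qed

lemma open_polydisc [simp]: "open (polydisc r :: (complex^'m::finite) set)"
proof -
  have "polydisc r = (\<Inter>i\<in>UNIV. {z :: complex^'m. cmod (z $ i) < r i})"
    by (auto simp: polydisc_def)
  moreover have "open {z :: complex^'m. cmod (z $ i) < r i}" for i
    by (intro open_Collect_less continuous_intros)
  ultimately show ?thesis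
    using open_INT[of UNIV "\<lambda>i. {z :: complex^'m. cmod (z $ i) < r i}"] by simp
qed

lemma continuous_on_proj1: "continuous_on S (proj1 :: complex^('n::finite + 'n) \<Rightarrow> complex^'n)"
  unfolding proj1_def by (intro continuous_on_vec_lambda continuous_intros)

lemma continuous_vcnj_pt: "continuous_on S (\<lambda>z :: complex^'n::finite. pt z (vcnj z))"
proof -
  have "continuous_on S (\<lambda>z :: complex^'n. \<chi> i. pt z (vcnj z) $ i)"
  proof (rule continuous_on_vec_lambda)
    fix i :: "'n + 'n"
    show "continuous_on S (\<lambda>z. pt z (vcnj z) $ i)"
      by (cases i) (auto intro!: continuous_intros)
  qed
  then show ?thesis by simp
qed

lemma pt_zero [simp]: "pt 0 0 = 0" "vcnj 0 = 0" "pt 0 (vcnj 0) = 0"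
  by (auto simp: vec_eq_iff pt_def vcnj_def split: sum.split)

text \<open>Since \<open>0\<close> is the only point of \<open>W\<close> over \<open>0\<close> and the projection is proper, germs at \<open>0\<close> control whole fibers
  of \<open>W\<close> near \<open>0\<close>.\<close>

lemma eventually_fiber:
  fixes W :: "(complex^('n::finite + 'n)) set"
  assumes rep: "segre_representative X k r s W" and P: "eventually P (nhds (0 :: complex^('n + 'n)))"
  shows "eventually (\<lambda>z. \<forall>\<zeta>\<in>fiber W z. P (pt z \<zeta>)) (nhds 0)"
proof -
  have D: "0 \<in> polydisc r" using rep by (simp add: segre_representative_def polydisc_def)
  obtain N where N: "open N" "0 \<in> N" "\<And>w. w \<in> N \<Longrightarrow> P w"
    using P by (auto simp: eventually_nhds)
  have "w \<in> N" if "w \<in> W" "proj1 w = 0" for w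
  proof -
    obtain z \<zeta> where w: "w = pt z \<zeta>" using pt_surj .
    have "\<zeta> \<in> fiber W 0" using that by (simp add: w fiber_def)
    then show ?thesis
      using rep that N(2) by (simp add: segre_representative_def w)
  qed
  then have "eventually (\<lambda>z. \<forall>w\<in>W. proj1 w = z \<longrightarrow> w \<in> N) (nhds 0)"
    using rep N(1) D
    by (intro proper_map_fibers_small[where D = "polydisc r"]) (auto simp: segre_representative_def)
  then show ?thesis
    by eventually_elim (use N in \<open>auto simp: fiber_def\<close>)
qed

text \<open>The functions defining \<open>W\<close> near \<open>0\<close> lie in its ideal, which consists of the complexifications of the germs
  vanishing on \<open>X\<close>.\<close>

lemma eventually_conjugate_point_in_representative:
  fixes X :: "(complex^'n::finite) set"
  assumes rep: "segre_representative X k r s W"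
  shows "eventually (\<lambda>z. z \<in> X \<longrightarrow> pt z (vcnj z) \<in> W) (nhds 0)"
proof -
  have "0 \<in> polydisc (case_sum r s)"
    using rep by (auto simp: segre_representative_def polydisc_def split: sum.split)
  moreover have "complex_subvariety W (polydisc (case_sum r s))"
    using rep by (simp add: segre_representative_def irreducible_subvariety_def)
  ultimately obtain U H where U: "open U" "0 \<in> U" and H: "finite H" "\<forall>h\<in>H. \<forall>x\<in>U. holo_at h x"
    and WU: "W \<inter> U = {x \<in> U. \<forall>h\<in>H. h x = 0}"
    unfolding complex_subvariety_def by blast
  have "eventually (\<lambda>z. z \<in> X \<longrightarrow> h (pt z (vcnj z)) = 0) (nhds 0)" if "h \<in> H" for h
  proof -
    have "eventually (\<lambda>x. x \<in> W \<longrightarrow> h x = 0) (nhds 0)"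
      unfolding eventually_nhds using U WU that by (intro exI[of _ U]) blast
    then have "h \<in> complexified_ideal X"
      using rep H(2) U(2) that by (auto simp: segre_representative_def holo_ideal_def)
    then show ?thesis
      by (simp add: complexified_ideal_def real_ideal_def)
  qed
  then have ev: "eventually (\<lambda>z. \<forall>h\<in>H. z \<in> X \<longrightarrow> h (pt z (vcnj z)) = 0) (nhds 0)"
    by (intro eventually_ball_finite[OF H(1)]) blast
  have "open ((\<lambda>z. pt z (vcnj z)) -` U)"
    using continuous_vcnj_pt open_vimage U(1) by blast
  then have "eventually (\<lambda>z. pt z (vcnj z) \<in> U) (nhds 0)"
    unfolding eventually_nhds using U(2) by (intro exI[of _ "(\<lambda>z. pt z (vcnj z)) -` U"]) auto
  with ev show ?thesis
    by eventually_elim (use WU in blast)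
qed

text \<open>A holomorphic function that is constant on the fibers of \<open>W\<close> descends to a holomorphic function of \<open>z\<close>:
  the descended function is continuous because the projection is proper, outside the branch locus it is
  \<open>F\<close> composed with a local holomorphic section, and the branch locus is contained in the zero set of a
  nontrivial holomorphic function.\<close>

lemma holo_at_fiber_constant:
  fixes F :: "complex^('n::finite + 'n) \<Rightarrow> complex"
  assumes rep: "segre_representative X k r s W" and k: "0 < k" and F: "holo_at F 0"
    and const: "eventually (\<lambda>z. \<forall>\<zeta>\<in>fiber W z. F (pt z \<zeta>) = a z) (nhds 0)"
  shows "holo_at a 0"
proof -
  let ?D = "polydisc r"
  have D: "0 \<in> ?D" using rep by (simp add: segre_representative_def polydisc_def)
  obtain \<epsilon> where \<epsilon>: "0 < \<epsilon>" "curve_holo F (polycyl 0 \<epsilon>)"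
    using F by (auto simp: holo_at_iff_curve_holo)
  have "eventually (\<lambda>w. w \<in> polycyl 0 \<epsilon>) (nhds (0 :: complex^('n + 'n)))"
    using \<epsilon>(1) by (auto simp: eventually_nhds_polycyl)
  from eventually_fiber[OF rep this] const
  have "eventually (\<lambda>z. \<forall>\<zeta>\<in>fiber W z. pt z \<zeta> \<in> polycyl 0 \<epsilon> \<and> F (pt z \<zeta>) = a z) (nhds 0)"
    by eventually_elim blast
  then obtain N where N: "open N" "0 \<in> N"
      "\<And>z \<zeta>. \<lbrakk>z \<in> N; \<zeta> \<in> fiber W z\<rbrakk> \<Longrightarrow> pt z \<zeta> \<in> polycyl 0 \<epsilon> \<and> F (pt z \<zeta>) = a z"
    unfolding eventually_nhds by blast
  have "open (N \<inter> ?D)" "0 \<in> N \<inter> ?D" using N D by auto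
  then obtain e where e: "0 < e" "cball 0 e \<subseteq> N \<inter> ?D"
    using open_contains_cball by blast
  have cont: "continuous_on (cball 0 e) a"
  proof (rule continuous_on_proper_descent[where W = W and D = ?D and \<pi> = proj1 and F = F])
    show "proper_map (top_of_set W) (top_of_set ?D) proj1"
      using rep by (simp add: segre_representative_def)
    show "cball 0 e \<subseteq> proj1 ` W"
    proof
      fix z :: "complex^'n" assume "z \<in> cball 0 e"
      then have "(\<Sum>\<zeta>\<in>fiber W z. fiber_mult W z \<zeta>) = k"
        using rep e by (auto simp: segre_representative_def)
      then obtain \<zeta> where "\<zeta> \<in> fiber W z" using k by fastforce
      then show "z \<in> proj1 ` W"
        unfolding fiber_def by (metis image_eqI mem_Collect_eq proj1_pt)
    qed
    have near: "w \<in> polycyl 0 \<epsilon> \<and> F w = a (proj1 w)" if "w \<in> W" "proj1 w \<in> cball 0 e" for w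
    proof -
      obtain z \<zeta> where w: "w = pt z \<zeta>" using pt_surj .
      show ?thesis using that N(3)[of z \<zeta>] e(2) by (auto simp: w fiber_def)
    qed
    show "continuous_on {w \<in> W. proj1 w \<in> cball 0 e} F"
      using near by (intro continuous_on_subset[OF curve_holo_continuous[OF \<epsilon>(2)]]) blast
    show "F w = a (proj1 w)" if "w \<in> W" "proj1 w \<in> cball 0 e" for w
      using near that by blast
  qed (use e continuous_on_proj1 in auto)
  have "generically_k_sheeted W ?D k"
    using rep by (simp add: segre_representative_def)
  then obtain E where E: "complex_subvariety E ?D" "interior E = {}"
    and sheets: "\<forall>p\<in>?D - E. \<exists>U \<sigma>. open U \<and> p \<in> U \<and> U \<subseteq> ?D \<and>
         (\<forall>j\<in>{1..k}. \<forall>x\<in>U. \<forall>i. holo_at (\<lambda>z. \<sigma> j z $ i) x) \<and>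
         (\<forall>z\<in>U. inj_on (\<lambda>j. \<sigma> j z) {1..k} \<and> fiber W z = (\<lambda>j. \<sigma> j z) ` {1..k})"
    unfolding generically_k_sheeted_def by (elim exE conjE) (rule that)
  obtain U H where U: "open U" "0 \<in> U" and H: "\<forall>h\<in>H. \<forall>x\<in>U. holo_at h x"
    and EU: "E \<inter> U = {x \<in> U. \<forall>h\<in>H. h x = 0}"
    using E(1) D unfolding complex_subvariety_def by blast
  have "open (U \<inter> ball 0 e)" "0 \<in> U \<inter> ball 0 e" using U e(1) by auto
  then obtain \<delta> where \<delta>: "0 < \<delta>" "polycyl 0 \<delta> \<subseteq> U \<inter> ball 0 e"
    using open_contains_polycyl by blast
  then have \<delta>_sub: "polycyl 0 \<delta> \<subseteq> U" "polycyl 0 \<delta> \<subseteq> cball (0 :: complex^'n) e"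
    using ball_subset_cball[of "0 :: complex^'n" e] by blast+
  have \<delta>_sub': "polycyl 0 \<delta> \<subseteq> N \<inter> ?D"
    using \<delta>_sub(2) e(2) by blast
  have "\<not> polycyl 0 \<delta> \<subseteq> E"
    using E(2) interior_maximal[of "polycyl 0 \<delta>" E] \<delta>(1)
    by (metis center_in_polycyl empty_iff open_polycyl subsetD)
  then obtain v h where v: "v \<in> polycyl 0 \<delta>" and h: "h \<in> H" "h v \<noteq> 0"
    using EU \<delta>_sub(1) by blast
  \<comment> \<open>The branch locus has empty interior, so one of its equations does not vanish identically.\<close>
  have "\<exists>r'>0. curve_holo a (polycyl 0 r')"
  proof (rule curve_holo_extends_over_zero_set[where h = h and v = v and p = 0 and r = \<delta>])
    show "continuous_on (polycyl 0 \<delta>) a"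
      by (rule continuous_on_subset[OF cont \<delta>_sub(2)])
    show "v \<in> polycyl 0 \<delta>" "h v \<noteq> 0" using v h(2) by auto
    show "curve_holo h (polycyl 0 \<delta>)"
      using H h(1) \<delta>_sub(1) by (intro curve_holo_if_holo_at) auto
  next
    fix x assume x: "x \<in> polycyl 0 \<delta>" "h x \<noteq> 0"
    have "x \<in> ?D - E" using x \<delta>_sub(1) \<delta>_sub' h(1) EU by blast
    from bspec[OF sheets this] obtain V \<sigma> where V: "open V" "x \<in> V"
      and \<sigma>: "\<forall>j\<in>{1..k}. \<forall>y\<in>V. \<forall>i. holo_at (\<lambda>z. \<sigma> j z $ i) y"
        "\<forall>z\<in>V. inj_on (\<lambda>j. \<sigma> j z) {1..k} \<and> fiber W z = (\<lambda>j. \<sigma> j z) ` {1..k}"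
      by (elim exE conjE) (rule that)
    have one: "1 \<in> {1..k}" using k by simp
    have \<sigma>_holo: "holo_at (\<lambda>z. \<sigma> 1 z $ i) y" if "y \<in> V" for y i
      using bspec[OF \<sigma>(1) one] that by blast
    have \<sigma>_fiber: "\<sigma> 1 z \<in> fiber W z" if "z \<in> V" for z
      using \<sigma>(2) that one by blast
    have "curve_holo (\<lambda>z. F (pt z (\<sigma> 1 z))) (V \<inter> N)"
    proof (rule curve_holo_compose[OF \<epsilon>(2)])
      fix i show "curve_holo (\<lambda>z. pt z (\<sigma> 1 z) $ i) (V \<inter> N)"
        by (cases i) (auto simp del: One_nat_def intro: curve_holo_if_holo_at \<sigma>_holo)
    qed (use N(3) \<sigma>_fiber in blast)
    then have "curve_holo a (V \<inter> N)"
      by (rule curve_holo_cong) (use N(3) \<sigma>_fiber in blast)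
    moreover have "x \<in> N" using x(1) \<delta>_sub' by blast
    ultimately show "\<exists>V. open V \<and> x \<in> V \<and> curve_holo a V"
      using V N(1) by (intro exI[of _ "V \<inter> N"]) auto
  qed
  then show ?thesis by (simp add: holo_at_iff_curve_holo)
qed

section \<open>The averaging criterion\<close>

theorem theorem4p4:
  fixes X :: "(complex^'n::finite) set" and k :: nat
    and A :: "(complex^'n \<Rightarrow> complex) \<Rightarrow> complex^'n \<Rightarrow> complex"
    and f :: "complex^'n \<Rightarrow> complex"
  assumes "irreducible_real_germ X"
    and "real_dim_germ X CARD('n)"
    and "segre_nondegenerate X"
    and "segre_multiplicity X k"
    and "averaging_operator X k A"
    and "real_analytic_at f 0"
  shows "(\<exists>g. holo_at g 0 \<and> eventually (\<lambda>z. z \<in> X \<longrightarrow> f z = g z) (nhds 0)) \<longleftrightarrow>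
    (\<forall>l\<in>{1..k}. germ_eq (A (\<lambda>z. f z ^ l)) (\<lambda>z. A f z ^ l))"
proof -
  obtain r s W \<xi> where rep: "segre_representative X k r s W"
    and enum: "fiber_enumeration W (polydisc r) k \<xi>"
    and A: "\<And>f. real_analytic_at f 0 \<Longrightarrow>
         germ_eq (A f) (\<lambda>z. (1 / of_nat k) * (\<Sum>j=1..k. complexify f (pt z (\<xi> j z))))"
    using assms(5) unfolding averaging_operator_def by blast
  define F where "F = complexify f"
  have F: "holo_at F 0" "germ_eq f (\<lambda>z. F (pt z (vcnj z)))"
    using complexify_props[OF assms(6)] by (simp_all add: F_def)
  have D: "0 \<in> polydisc r" using rep by (simp add: segre_representative_def polydisc_def)
  have k: "0 < k"
  proof -
    have "fiber W 0 = (\<lambda>j. \<xi> j 0) ` {1..k}" "fiber W 0 = {0}"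
      using enum rep D by (auto simp: fiber_enumeration_def segre_representative_def)
    then show ?thesis by (cases k) auto
  qed
  have "eventually (\<lambda>z. z \<in> polydisc r) (nhds 0)"
    using D by (auto simp: eventually_nhds intro: exI[of _ "polydisc r"])
  then have fib: "eventually (\<lambda>z. fiber W z = (\<lambda>j. \<xi> j z) ` {1..k}) (nhds 0)"
    by eventually_elim (use enum in \<open>simp add: fiber_enumeration_def\<close>)
  \<comment> \<open>By uniqueness of the complexification, the averages are normalized power sums of the values
    of the single function \<open>F\<close> on the fiber.\<close>
  have average: "germ_eq (A (\<lambda>z. f z ^ l)) (\<lambda>z. (1 / of_nat k) * (\<Sum>j=1..k. F (pt z (\<xi> j z)) ^ l))" for l
  proof -
    have Fl: "germ_eq (\<lambda>z. f z ^ l) (\<lambda>z. F (pt z (vcnj z)) ^ l)"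
      using F(2) by eventually_elim simp
    have ra: "real_analytic_at (\<lambda>z. f z ^ l) 0"
      unfolding real_analytic_at_def using holo_at_power[OF F(1)] Fl by (intro exI[of _ "\<lambda>w. F w ^ l"]) auto
    have "germ_eq (\<lambda>z. complexify (\<lambda>z. f z ^ l) (pt z (vcnj z))) (\<lambda>z. F (pt z (vcnj z)) ^ l)"
      using germ_eq_complexify[OF ra] Fl by eventually_elim simp
    then have "germ_eq (complexify (\<lambda>z. f z ^ l)) (\<lambda>w. F w ^ l)"
      by (rule germ_eq_complexification_unique[OF holo_at_complexify[OF ra] holo_at_power[OF F(1)]])
    from eventually_fiber[OF rep this] fib A[OF ra] show ?thesis
      by eventually_elim simp
  qed
  show ?thesis
  proof
    assume "\<exists>g. holo_at g 0 \<and> eventually (\<lambda>z. z \<in> X \<longrightarrow> f z = g z) (nhds 0)"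
    then obtain g where g: "holo_at g 0" "eventually (\<lambda>z. z \<in> X \<longrightarrow> f z = g z) (nhds 0)" by blast
    \<comment> \<open>\<open>F(z, \<xi>) - g(z)\<close> vanishes at the points \<open>(z, cnj z)\<close> with \<open>z\<close> in \<open>X\<close>, hence on all of \<open>W\<close>.\<close>
    define G where "G = (\<lambda>w. F w - g (proj1 w))"
    have G: "holo_at G 0" unfolding G_def by (intro holo_at_diff holo_at_proj1 F(1) g(1))
    have "eventually (\<lambda>z. z \<in> X \<longrightarrow> G (pt z (vcnj z)) = 0) (nhds 0)"
      using F(2) g(2) by eventually_elim (simp add: G_def)
    with G have "G \<in> complexified_ideal X"
      by (auto simp: complexified_ideal_def real_ideal_def real_analytic_at_def)
    then have "eventually (\<lambda>w. w \<in> W \<longrightarrow> G w = 0) (nhds 0)"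
      using rep by (auto simp: segre_representative_def holo_ideal_def)
    from eventually_fiber[OF rep this] fib
    have Fg: "eventually (\<lambda>z. \<forall>j\<in>{1..k}. F (pt z (\<xi> j z)) = g z) (nhds 0)"
      by eventually_elim (auto simp: fiber_def G_def)
    have Ag: "germ_eq (A (\<lambda>z. f z ^ l)) (\<lambda>z. g z ^ l)" for l
      using average[of l] Fg by eventually_elim (use k in simp)
    show "\<forall>l\<in>{1..k}. germ_eq (A (\<lambda>z. f z ^ l)) (\<lambda>z. A f z ^ l)"
    proof
      fix l
      show "germ_eq (A (\<lambda>z. f z ^ l)) (\<lambda>z. A f z ^ l)"
        using Ag[of l] Ag[of 1] by eventually_elim simp
    qed
  next
    assume "\<forall>l\<in>{1..k}. germ_eq (A (\<lambda>z. f z ^ l)) (\<lambda>z. A f z ^ l)"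
    then have "eventually (\<lambda>z. \<forall>l\<in>{1..k}. A (\<lambda>z. f z ^ l) z = A f z ^ l) (nhds 0)"
      by (simp add: eventually_ball_finite)
    moreover have "eventually (\<lambda>z. \<forall>l\<in>{1..k}. A (\<lambda>z. f z ^ l) z =
        (1 / of_nat k) * (\<Sum>j=1..k. F (pt z (\<xi> j z)) ^ l)) (nhds 0)"
      using average by (simp add: eventually_ball_finite)
    ultimately have const: "eventually (\<lambda>z. \<forall>\<zeta>\<in>fiber W z. F (pt z \<zeta>) = A f z) (nhds 0)"
      using fib
    proof eventually_elim
      case (elim z)
      have "F (pt z (\<xi> j z)) = A f z" if "j \<in> {1..k}" for j
      proof (rule all_equal_if_power_sums_equal[where J = "{1..k}" and y = "\<lambda>j. F (pt z (\<xi> j z))"])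
        fix l assume "l \<in> {1..card {1..k}}"
        then have "(1 / of_nat k) * (\<Sum>j=1..k. F (pt z (\<xi> j z)) ^ l) = A f z ^ l"
          using elim by simp
        then show "(\<Sum>j=1..k. F (pt z (\<xi> j z)) ^ l) = of_nat (card {1..k}) * A f z ^ l"
          using k by (simp add: field_simps)
      qed (use that in auto)
      with elim show ?case by auto
    qed
    have "holo_at (A f) 0" by (rule holo_at_fiber_constant[OF rep k F(1) const])
    moreover have "eventually (\<lambda>z. z \<in> X \<longrightarrow> f z = A f z) (nhds 0)"
      using const eventually_conjugate_point_in_representative[OF rep] F(2)
      by eventually_elim (auto simp: fiber_def)
    ultimately show "\<exists>g. holo_at g 0 \<and> eventually (\<lambda>z. z \<in> X \<longrightarrow> f z = g z) (nhds 0)" by blast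
  qed
qed

end
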